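(* (John--Nirenberg inequality) There exist two positive constants $\eta$ and $A$ such that for any $f$ in $BMO$ with $\|f\|_*\neq 0$ $$\sup_{R\in\mathcal{R}}\frac{1}{\rho(R)}\int_R\exp\Big(\frac{\eta}{\|f\|_*}|f-f_R|\Big)\,d\rho\leq A.$$
   Context: Let $d\geq 1$ be an integer and $S=\mathbb{R}^d\ltimes\mathbb{R}^+$ the group with product $(x,a)\cdot(x',a')=(x+a\,x',a\,a')$, endowed with the right Haar measure $d\rho(x,a)=a^{-1}\,dx\,da$. A Calderón--Zygmund set is a set $R=Q\times[ae^{-r},ae^r]$, where $Q$ is a dyadic cube in $\mathbb{R}^d$ of side $L$, $a\in\mathbb{R}^+$, $r>0$, and $e^2ar\leq L<e^8ar$ if $r<1$, while $ae^{2r}\leq L<ae^{8r}$ if $r\geq1$. $\mathcal{R}$ denotes the family of all Calderón--Zygmund sets. For a locally integrable (complex-valued) function $f$ on $S$ and $R\in\mathcal{R}$, $f_R=\frac{1}{\rho(R)}\int_Rf\,d\rho$. Put $\|f\|_*=\sup_{R\in\mathcal{R}}\frac{1}{\rho(R)}\int_R|f-f_R|\,d\rho$. $BMO$ is the space of all $f\in L^1_{\mathrm{loc}}$ with $\|f\|_*<\infty$, modulo constant functions, with norm $\|\cdot\|_*$. *)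

theory Defs
  imports "HOL-Analysis.Analysis"
begin

text \<open>
  The group is \<open>\<real>\<^sup>d \<ltimes> \<real>\<^sup>+\<close> with product \<open>(x, a) \<cdot> (x', a') = (x + a x', a a')\<close>, where
  \<open>d = CARD('n)\<close>. Its underlying set is the open upper half-space; functions on the group are
  total functions on \<open>(real ^ 'n) \<times> real\<close> whose values outside \<open>axb_carrier\<close> are irrelevant.
\<close>

definition axb_carrier :: "((real ^ 'n) \<times> real) set" where
  "axb_carrier = UNIV \<times> {0<..}"

text \<open>
  The right Haar measure \<open>a\<^sup>-\<^sup>1 dx da\<close>, on the Lebesgue (not merely Borel) measurable subsets of
  the group.
\<close>

definition axb_rho :: "((real ^ 'n) \<times> real) measure" where
  "axb_rho = density (restrict_space lebesgue axb_carrier) (\<lambda>(x, a). ennreal (1 / a))"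

definition dyadic_cube :: "int \<Rightarrow> ('n \<Rightarrow> int) \<Rightarrow> (real ^ 'n) set" where
  "dyadic_cube k m =
     {x. \<forall>i. 2 powi k * of_int (m i) \<le> x $ i \<and> x $ i < 2 powi k * (of_int (m i) + 1)}"

text \<open>The real number \<open>2 powi k\<close> is the side length \<open>L\<close> of \<open>dyadic_cube k m\<close>.\<close>

definition CZ_admissible :: "real \<Rightarrow> real \<Rightarrow> real \<Rightarrow> bool" where
  "CZ_admissible L a r \<longleftrightarrow>
     (if r < 1 then exp 2 * a * r \<le> L \<and> L < exp 8 * a * r
      else a * exp (2 * r) \<le> L \<and> L < a * exp (8 * r))"

definition CZ_sets :: "((real ^ 'n) \<times> real) set set" where
  "CZ_sets = {dyadic_cube k m \<times> {a * exp (- r)..a * exp r} | k m a r.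
                a > 0 \<and> r > 0 \<and> CZ_admissible (2 powi k) a r}"

definition axb_locally_integrable :: "((real ^ 'n) \<times> real \<Rightarrow> complex) \<Rightarrow> bool" where
  "axb_locally_integrable f \<longleftrightarrow>
     (\<forall>K. compact K \<and> K \<subseteq> axb_carrier \<longrightarrow> set_integrable axb_rho K f)"

definition CZ_mean :: "((real ^ 'n) \<times> real \<Rightarrow> complex) \<Rightarrow> ((real ^ 'n) \<times> real) set \<Rightarrow> complex" where
  "CZ_mean f R = (LINT p:R|axb_rho. f p) /\<^sub>R measure axb_rho R"

text \<open>
  The supremum is taken in \<open>ennreal\<close>, so that it is meaningful (possibly \<open>\<infinity>\<close>) for every locally
  integrable function.
\<close>

definition BMO_norm :: "((real ^ 'n) \<times> real \<Rightarrow> complex) \<Rightarrow> ennreal" where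
  "BMO_norm f =
     (SUP R\<in>CZ_sets. (\<integral>\<^sup>+p\<in>R. ennreal (norm (f p - CZ_mean f R)) \<partial>axb_rho) / emeasure axb_rho R)"

text \<open>
  Representatives of the elements of \<open>BMO\<close>: functions are not identified modulo constants
  (or null sets).
\<close>

definition BMO :: "((real ^ 'n) \<times> real \<Rightarrow> complex) set" where
  "BMO = {f. axb_locally_integrable f \<and> BMO_norm f < \<infinity>}"

end

theory Submission
  imports Defs
begin

text \<open>
  The classical proof of the John-Nirenberg inequality stops the repeated subdivision of a set \<open>R\<close> at
  the first cells on which the mean of \<open>f\<close> is far from \<open>f\<^sub>R\<close>, bounds the total measure of these cells, and
  iterates inside them. Two things are needed: a way to split a Calderon-Zygmund set into finitely
  many Calderon-Zygmund sets of comparable measure, and a reason why \<open>f\<close> is close to \<open>f\<^sub>R\<close> off the stopping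
  cells. The second is usually Lebesgue differentiation; it is avoided here by working at a finite
  depth \<open>n\<close> first.

  \<^bold>\<open>Finite depth.\<close> Let \<open>f\<^sub>n\<close> be the function equal to \<open>f\<^sub>T\<close> on each cell \<open>T\<close> of generation \<open>n\<close>
  below \<open>R\<close>. Suppose that the oscillations of \<open>f\<close> are at most \<open>B\<close> and that no child has measure less than
  \<open>1/N\<close> times that of its parent. Then the means over parent and child differ by at most \<open>NB\<close>. With the
  stopping rule \<open>\<bar>f\<^sub>T - f\<^sub>R\<bar> > 2B\<close> the stopping cells have total measure at most \<open>\<rho>(R)/2\<close>, and
  \<open>\<bar>f\<^sub>T - f\<^sub>R\<bar> \<le> (2+N)B\<close> on them. If \<open>exp(\<kappa>(2+N)B) = 3/2\<close> and the exponential mean of \<open>\<kappa>\<bar>f\<^sub>m - f\<^sub>T\<bar>\<close>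
  over every cell \<open>T\<close> is at most \<open>6\<close> for all depths \<open>m < n\<close>, then at depth \<open>n\<close> it is at most
  \<open>3/2 + (3/2)(1/2)6 = 6\<close>. So the bound \<open>6\<close> holds at all depths (\<open>leaf_sum_exp_le\<close>).

  \<^bold>\<open>Infinite depth.\<close> The distance of \<open>f\<^sub>n\<close> to \<open>f\<close> in \<open>L\<^sup>1(R)\<close> is the sum of the unnormalised
  oscillations of \<open>f\<close> over the cells of generation \<open>n\<close>. It becomes small if \<open>f\<close> is uniformly continuous,
  because the cells shrink, and then for all integrable \<open>f\<close> by density
  (\<open>integrable_approx_uniformly_continuous\<close>, \<open>leaf_sum_oscillation_small\<close>). The truncations
  \<open>exp(\<kappa> min(t, K))\<close> are Lipschitz in \<open>t\<close>, so the bound \<open>6\<close> passes to \<open>f\<close> for each \<open>K\<close>, and monotone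
  convergence in \<open>K\<close> removes the truncation (\<open>exponential_integrability\<close>).

  \<^bold>\<open>Geometry.\<close> A set \<open>Q \<times> [a exp(-r), a exp r]\<close> has measure \<open>2 r L\<^sup>d\<close>. If \<open>L/2\<close> is still at least the
  admissible lower bound, \<open>Q\<close> is cut into its \<open>2\<^sup>d\<close> dyadic children; otherwise the interval is halved on
  the logarithmic scale. The constants \<open>2\<close> and \<open>8\<close> in the admissibility condition leave enough room for
  the halves to be admissible again (\<open>CZ_admissible_halve_radius\<close>, \<open>CZ_set_split\<close>). Hence \<open>N = 2\<^sup>d\<close>. Each
  step at least halves the measure, and inside a fixed set a cell of small measure has small diameter
  (\<open>CZ_set_diameter_small\<close>).
\<close>

section \<open>Means and oscillations over a set\<close>

definition mean_on :: "'a measure \<Rightarrow> ('a \<Rightarrow> 'b::{banach, second_countable_topology}) \<Rightarrow> 'a set \<Rightarrow> 'b"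
  where "mean_on M f S = (LINT x:S|M. f x) /\<^sub>R measure M S"

text \<open>
  The integral is not divided by the measure of \<open>S\<close>: in this form the values over the cells of a
  partition add up to the \<open>L\<^sup>1\<close> distance of \<open>f\<close> to the function that is its mean on each cell.
  A mean oscillation of at most \<open>B\<close> reads \<open>oscillation M f S \<le> B * measure M S\<close>.
\<close>

definition oscillation :: "'a measure \<Rightarrow> ('a \<Rightarrow> 'b::{banach, second_countable_topology}) \<Rightarrow> 'a set \<Rightarrow> real"
  where "oscillation M f S = (LINT x:S|M. norm (f x - mean_on M f S))"

text \<open>
  Since \<open>measure\<close> is \<open>0\<close> on sets of infinite measure, \<open>0 < measure M S\<close> expresses that \<open>S\<close> has
  positive and finite measure.
\<close>

lemma emeasure_finite_if_measure_pos: "0 < measure M S \<Longrightarrow> emeasure M S \<noteq> \<infinity>"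
  by (auto simp: measure_def)

lemma set_integrable_const_measure_pos:
  fixes c :: "'b::{banach, second_countable_topology}"
  assumes "S \<in> sets M" "0 < measure M S"
  shows "set_integrable M S (\<lambda>_. c)"
  unfolding set_integrable_def
  using assms emeasure_finite_if_measure_pos[OF assms(2)]
  by (intro integrable_scaleR_left integrable_real_indicator) (auto simp: less_top)

lemma set_integral_const_measure_pos:
  fixes c :: "'b::{banach, second_countable_topology}"
  assumes "S \<in> sets M" "0 < measure M S"
  shows "(LINT x:S|M. c) = measure M S *\<^sub>R c"
  using assms emeasure_finite_if_measure_pos[OF assms(2)] by (intro set_integral_const) auto

lemma norm_mean_on_diff_le:
  fixes f :: "'a \<Rightarrow> 'b::{banach, second_countable_topology}"
  assumes S: "S \<in> sets M" "0 < measure M S" and f: "set_integrable M S f"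
  shows "norm (mean_on M f S - c) * measure M S \<le> (LINT x:S|M. norm (f x - c))"
proof -
  note c = set_integrable_const_measure_pos[OF S, of c]
  have "(LINT x:S|M. f x - c) = measure M S *\<^sub>R (mean_on M f S - c)"
    using set_integral_diff(2)[OF f c] S
    by (simp add: set_integral_const_measure_pos mean_on_def scaleR_diff_right)
  then have "norm (mean_on M f S - c) * measure M S = norm (LINT x:S|M. f x - c)"
    by (simp add: mult.commute)
  also have "\<dots> \<le> (LINT x:S|M. norm (f x - c))"
    by (rule set_integral_norm_bound[OF set_integral_diff(1)[OF f c]])
  finally show ?thesis .
qed

lemma set_integral_norm_nonneg: "0 \<le> (LINT x:S|M. norm (f x))"
  unfolding set_lebesgue_integral_def by (intro Bochner_Integration.integral_nonneg) auto

lemma set_integrable_norm_diff_const: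
  fixes f :: "'a \<Rightarrow> 'b::{banach, second_countable_topology}"
  assumes "S \<in> sets M" "0 < measure M S" "set_integrable M S f"
  shows "set_integrable M S (\<lambda>x. norm (f x - c))"
  using assms by (intro set_integrable_norm set_integral_diff(1) set_integrable_const_measure_pos)

text \<open>
  Replacing \<open>f\<close> by \<open>g\<close> costs the distance twice: once for the function and once for its mean.
\<close>

lemma oscillation_le_add_dist:
  fixes f g :: "'a \<Rightarrow> 'b::{banach, second_countable_topology}"
  assumes S: "S \<in> sets M" "0 < measure M S" and f: "set_integrable M S f" and g: "set_integrable M S g"
  shows "oscillation M f S \<le> oscillation M g S + 2 * (LINT x:S|M. norm (f x - g x))"
proof -
  let ?mf = "mean_on M f S" and ?mg = "mean_on M g S"
  have fg: "set_integrable M S (\<lambda>x. norm (f x - g x))"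
    using f g by (intro set_integrable_norm set_integral_diff(1))
  have gg: "set_integrable M S (\<lambda>x. norm (g x - ?mg))"
    by (rule set_integrable_norm_diff_const[OF S g])
  have c: "set_integrable M S (\<lambda>x. norm (?mg - ?mf))"
    by (rule set_integrable_const_measure_pos[OF S])
  have "oscillation M f S \<le> (LINT x:S|M. (norm (f x - g x) + norm (g x - ?mg)) + norm (?mg - ?mf))"
    unfolding oscillation_def
  proof (rule set_integral_mono[OF set_integrable_norm_diff_const[OF S f]
        set_integral_add(1)[OF set_integral_add(1)[OF fg gg] c]])
    fix x
    have "f x - ?mf = (f x - g x) + (g x - ?mg) + (?mg - ?mf)" by simp
    then show "norm (f x - ?mf) \<le> norm (f x - g x) + norm (g x - ?mg) + norm (?mg - ?mf)"
      using norm_triangle_ineq[of "(f x - g x) + (g x - ?mg)" "?mg - ?mf"]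
        norm_triangle_ineq[of "f x - g x" "g x - ?mg"] by simp
  qed
  also have "\<dots> = (LINT x:S|M. norm (f x - g x)) + oscillation M g S + measure M S * norm (?mg - ?mf)"
    using set_integral_add(2)[OF set_integral_add(1)[OF fg gg] c] set_integral_add(2)[OF fg gg]
      set_integral_const_measure_pos[OF S, of "norm (?mg - ?mf)"]
    by (simp add: oscillation_def)
  also have "measure M S * norm (?mg - ?mf) \<le> (LINT x:S|M. norm (f x - g x))"
  proof -
    have "measure M S *\<^sub>R (?mg - ?mf) = (LINT x:S|M. g x - f x)"
      using S set_integral_diff(2)[OF g f] by (simp add: mean_on_def scaleR_diff_right)
    then have "measure M S * norm (?mg - ?mf) = norm (LINT x:S|M. g x - f x)"
      using S(2) by (metis norm_scaleR abs_of_pos)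
    also have "\<dots> \<le> (LINT x:S|M. norm (g x - f x))"
      by (rule set_integral_norm_bound[OF set_integral_diff(1)[OF g f]])
    finally show ?thesis by (simp add: norm_minus_commute)
  qed
  finally show ?thesis by simp
qed

lemma oscillation_le_if_dist_le:
  fixes g :: "'a \<Rightarrow> 'b::{banach, second_countable_topology}"
  assumes S: "S \<in> sets M" "0 < measure M S" and g: "set_integrable M S g"
    and e: "\<And>x y. x \<in> S \<Longrightarrow> y \<in> S \<Longrightarrow> norm (g x - g y) \<le> e"
  shows "oscillation M g S \<le> e * measure M S"
proof -
  have "norm (g x - mean_on M g S) \<le> e" if x: "x \<in> S" for x
  proof -
    have "norm (mean_on M g S - g x) * measure M S \<le> (LINT y:S|M. norm (g y - g x))"
      by (rule norm_mean_on_diff_le[OF S g])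
    also have "\<dots> \<le> (LINT y:S|M. e)"
      by (intro set_integral_mono set_integrable_norm_diff_const set_integrable_const_measure_pos S g e x)
    also have "\<dots> = e * measure M S"
      using S by (simp add: set_integral_const_measure_pos)
    finally show ?thesis using S(2) by (simp add: norm_minus_commute)
  qed
  then have "oscillation M g S \<le> (LINT y:S|M. e)"
    unfolding oscillation_def
    by (intro set_integral_mono set_integrable_norm_diff_const set_integrable_const_measure_pos S g)
  also have "\<dots> = e * measure M S"
    using S by (simp add: set_integral_const_measure_pos)
  finally show ?thesis .
qed

section \<open>The abstract John-Nirenberg inequality\<close>

text \<open>
  The sum of \<open>F\<close> over the cells of generation \<open>n\<close> below \<open>S\<close>. The recursion over the tree replaces a sum over
  the set of these cells, so that induction on the depth needs no disjointness of subtrees.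
\<close>

primrec leaf_sum :: "('a set \<Rightarrow> 'a set set) \<Rightarrow> ('a set \<Rightarrow> real) \<Rightarrow> nat \<Rightarrow> 'a set \<Rightarrow> real" where
  "leaf_sum kids F 0 S = F S"
| "leaf_sum kids F (Suc n) S = (\<Sum>T\<in>kids S. leaf_sum kids F n T)"

primrec generation :: "('a set \<Rightarrow> 'a set set) \<Rightarrow> nat \<Rightarrow> 'a set \<Rightarrow> 'a set set" where
  "generation kids 0 S = {S}"
| "generation kids (Suc n) S = (\<Union>T\<in>kids S. generation kids n T)"

text \<open>
  The abstract setting of the stopping argument: a dyadic tree without a geometry. Children of a cell
  may overlap in null sets, as the two halves of a closed interval do. The last condition is the
  doubling property along the tree.
\<close>

locale splitting_family =
  fixes M :: "'a measure" and D :: "'a set set" and kids :: "'a set \<Rightarrow> 'a set set" and N :: real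
  assumes cell_sets: "S \<in> D \<Longrightarrow> S \<in> sets M"
    and cell_pos: "S \<in> D \<Longrightarrow> 0 < measure M S"
    and kids_finite: "S \<in> D \<Longrightarrow> finite (kids S)"
    and kids_cells: "S \<in> D \<Longrightarrow> kids S \<subseteq> D"
    and kids_Union: "S \<in> D \<Longrightarrow> \<Union>(kids S) = S"
    and kids_AE_disjoint: "S \<in> D \<Longrightarrow> T \<in> kids S \<Longrightarrow> T' \<in> kids S \<Longrightarrow> T \<noteq> T' \<Longrightarrow>
           AE x in M. \<not> (x \<in> T \<and> x \<in> T')"
    and kids_measure: "S \<in> D \<Longrightarrow> T \<in> kids S \<Longrightarrow> measure M S \<le> N * measure M T"
begin

lemma kid_cell: "S \<in> D \<Longrightarrow> T \<in> kids S \<Longrightarrow> T \<in> D"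
  using kids_cells by blast

lemma kid_subset: "S \<in> D \<Longrightarrow> T \<in> kids S \<Longrightarrow> T \<subseteq> S"
  using kids_Union by blast

lemma set_integrable_kid:
  fixes g :: "'a \<Rightarrow> 'b::{banach, second_countable_topology}"
  shows "S \<in> D \<Longrightarrow> T \<in> kids S \<Longrightarrow> set_integrable M S g \<Longrightarrow> set_integrable M T g"
  by (meson cell_sets kid_cell kid_subset set_integrable_subset)

lemma set_integral_kids:
  fixes g :: "'a \<Rightarrow> 'b::{banach, second_countable_topology}"
  assumes S: "S \<in> D" and g: "set_integrable M S g"
  shows "(LINT x:S|M. g x) = (\<Sum>T\<in>kids S. LINT x:T|M. g x)"
proof -
  have "(LINT x:(\<Union>T\<in>kids S. T)|M. g x) = (\<Sum>T\<in>kids S. LINT x:T|M. g x)"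
  proof (rule set_integral_finite_UN_AE[OF kids_finite[OF S]])
    fix T T' assume "T \<in> kids S" "T' \<in> kids S"
    then show "AE x in M. x \<in> T \<and> x \<in> T' \<longrightarrow> T = T'"
      using kids_AE_disjoint[OF S, of T T'] by (cases "T = T'") auto
  qed (use S g kid_cell cell_sets set_integrable_kid in blast)+
  then show ?thesis using kids_Union[OF S] by simp
qed

lemma leaf_sum_le:
  assumes "R \<in> D" and "\<And>T. T \<in> D \<Longrightarrow> T \<in> generation kids n R \<Longrightarrow> T \<subseteq> R \<Longrightarrow> F T \<le> G T"
  shows "leaf_sum kids F n R \<le> leaf_sum kids G n R"
  using assms
proof (induction n arbitrary: R)
  case (Suc n)
  have "leaf_sum kids F n T \<le> leaf_sum kids G n T" if T: "T \<in> kids R" for T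
  proof (rule Suc.IH[OF kid_cell[OF Suc.prems(1) T]])
    fix U assume "U \<in> D" "U \<in> generation kids n T" "U \<subseteq> T"
    then show "F U \<le> G U"
      using Suc.prems T kid_subset[OF Suc.prems(1) T] by (intro Suc.prems(2)) auto
  qed
  then show ?case by (simp add: sum_mono)
qed simp

lemma leaf_sum_add: "leaf_sum kids (\<lambda>T. F T + G T) n R = leaf_sum kids F n R + leaf_sum kids G n R"
  by (induction n arbitrary: R) (simp_all add: sum.distrib)

lemma leaf_sum_cmult: "leaf_sum kids (\<lambda>T. c * F T) n R = c * leaf_sum kids F n R"
  by (induction n arbitrary: R) (simp_all add: sum_distrib_left)

lemma leaf_sum_set_integral:
  fixes g :: "'a \<Rightarrow> real"
  assumes "R \<in> D" "set_integrable M R g"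
  shows "leaf_sum kids (\<lambda>T. LINT x:T|M. g x) n R = (LINT x:R|M. g x)"
  using assms
proof (induction n arbitrary: R)
  case (Suc n)
  then have "leaf_sum kids (\<lambda>T. LINT x:T|M. g x) n T = (LINT x:T|M. g x)" if "T \<in> kids R" for T
    using that kid_cell set_integrable_kid by blast
  then show ?case using Suc.prems by (simp add: set_integral_kids)
qed simp

lemma set_integral_one: "S \<in> D \<Longrightarrow> (LINT x:S|M. 1::real) = measure M S"
  using set_integral_const_measure_pos[OF cell_sets cell_pos, of S "1::real"] by simp

lemma set_integrable_one: "S \<in> D \<Longrightarrow> set_integrable M S (\<lambda>_. 1::real)"
  by (simp add: cell_pos cell_sets set_integrable_const_measure_pos)

lemma measure_kids:
  assumes S: "S \<in> D"
  shows "measure M S = (\<Sum>T\<in>kids S. measure M T)"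
proof -
  have "(LINT x:T|M. 1::real) = measure M T" if "T \<in> kids S" for T
    using that kid_cell[OF S] by (intro set_integral_one)
  then show ?thesis
    using set_integral_kids[OF S set_integrable_one[OF S]] set_integral_one[OF S] by simp
qed

lemma leaf_sum_measure:
  assumes "R \<in> D"
  shows "leaf_sum kids (measure M) n R = measure M R"
  using assms
proof (induction n arbitrary: R)
  case (Suc n)
  then have "leaf_sum kids (measure M) n T = measure M T" if "T \<in> kids R" for T
    using that kid_cell by blast
  then show ?case using measure_kids[OF Suc.prems] by simp
qed simp

text \<open>
  The mean over a child sees at most the full oscillation over the parent, divided by a measure that is
  at least \<open>1/N\<close> times that of the parent.
\<close>

lemma norm_mean_kid_diff_le:
  fixes f :: "'a \<Rightarrow> 'b::{banach, second_countable_topology}"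
  assumes S: "S \<in> D" and T: "T \<in> kids S" and f: "set_integrable M S f"
    and B: "oscillation M f S \<le> B * measure M S" and "0 \<le> B"
  shows "norm (mean_on M f T - mean_on M f S) \<le> N * B"
proof -
  have TD: "T \<in> D" using S T kid_cell by blast
  have osc: "set_integrable M S (\<lambda>x. norm (f x - mean_on M f S))"
    by (rule set_integrable_norm_diff_const[OF cell_sets[OF S] cell_pos[OF S] f])
  have "norm (mean_on M f T - mean_on M f S) * measure M T
      \<le> (LINT x:T|M. norm (f x - mean_on M f S))"
    by (rule norm_mean_on_diff_le[OF cell_sets[OF TD] cell_pos[OF TD] set_integrable_kid[OF S T f]])
  also have "\<dots> \<le> oscillation M f S"
    unfolding oscillation_def
    using set_integral_kids[OF S osc] member_le_sum[OF T _ kids_finite[OF S],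
        of "\<lambda>T. LINT x:T|M. norm (f x - mean_on M f S)"]
    by (simp add: set_integral_norm_nonneg)
  also have "\<dots> \<le> B * (N * measure M T)"
    using B mult_left_mono[OF kids_measure[OF S T] \<open>0 \<le> B\<close>] by linarith
  finally show ?thesis using cell_pos[OF TD] by (simp add: mult.assoc[symmetric] mult.commute)
qed

text \<open>
  The stopping argument at finite depth. The exponent \<open>\<kappa>\<close> is chosen so that \<open>exp(\<kappa>(2+N)B) = 3/2\<close>, and
  \<open>6\<close> is the fixed point of \<open>A \<mapsto> 3/2 + 3/4 A\<close>.
\<close>

lemma leaf_sum_exp_le:
  fixes f :: "'a \<Rightarrow> 'b::{banach, second_countable_topology}"
  assumes "0 < B" "0 < N" and R: "R \<in> D"
    and int: "\<And>S. S \<in> D \<Longrightarrow> set_integrable M S f"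
    and osc: "\<And>S. S \<in> D \<Longrightarrow> oscillation M f S \<le> B * measure M S"
  defines "\<kappa> \<equiv> ln (3/2) / (2 + N) / B"
  shows "leaf_sum kids (\<lambda>T. measure M T * exp (\<kappa> * norm (mean_on M f T - mean_on M f R))) n R
    \<le> 6 * measure M R"
  using R
proof (induction n arbitrary: R rule: less_induct)
  case (less n)
  have \<kappa>: "0 < \<kappa>" using assms(1,2) by (simp add: \<kappa>_def)
  define I where "I c m S = leaf_sum kids (\<lambda>T. measure M T * exp (\<kappa> * norm (mean_on M f T - c))) m S"
    for c m S
  \<comment> \<open>Recentring from \<open>f\<^sub>S\<close> to \<open>c\<close> multiplies the exponential sum below \<open>S\<close> by at most \<open>exp(\<kappa>\<bar>f\<^sub>S - c\<bar>)\<close>.\<close>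
  have shift: "I c m S \<le> exp (\<kappa> * norm (mean_on M f S - c)) * I (mean_on M f S) m S"
    if "S \<in> D" for c m S
    unfolding I_def leaf_sum_cmult[symmetric]
  proof (rule leaf_sum_le[OF that])
    fix T
    have "norm (mean_on M f T - c) \<le> norm (mean_on M f S - c) + norm (mean_on M f T - mean_on M f S)"
      by (metis add.commute diff_add_cancel diff_add_eq norm_triangle_ineq)
    then have "exp (\<kappa> * norm (mean_on M f T - c))
        \<le> exp (\<kappa> * norm (mean_on M f S - c)) * exp (\<kappa> * norm (mean_on M f T - mean_on M f S))"
      using \<kappa> by (simp flip: exp_add distrib_left)
    then show "measure M T * exp (\<kappa> * norm (mean_on M f T - c))
        \<le> exp (\<kappa> * norm (mean_on M f S - c)) *
          (measure M T * exp (\<kappa> * norm (mean_on M f T - mean_on M f S)))"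
      by (simp add: mult.left_commute[of _ "measure M T"] mult_left_mono)
  qed
  define c where "c = mean_on M f R"
  have small: "exp (\<kappa> * (2 * B + N * B)) = 3/2"
  proof -
    have "\<kappa> * (2 * B + N * B) = ln (3/2)"
    proof -
      have "2 * B + N * B = (2 + N) * B" by (simp add: algebra_simps)
      then show ?thesis using assms(1,2) by (simp add: \<kappa>_def)
    qed
    then show ?thesis by simp
  qed
  have small': "exp (\<kappa> * (2 * B)) \<le> 3/2"
    unfolding small[symmetric] using \<kappa> assms(1,2) by simp
  \<comment> \<open>The stopping cells are not constructed. Below a cell whose mean is still within \<open>2B\<close> of \<open>c\<close>, leaves
    reached without stopping contribute at most \<open>3/2\<close> times their measure; a stopping cell \<open>T\<close>
    contributes at most \<open>(3/2) * 6\<close> times its measure, and its measure is at most \<open>1/(2B)\<close> times the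
    integral of \<open>\<bar>f - c\<bar>\<close> over \<open>T\<close>. Hence the factor \<open>9/(2B)\<close>, and induction on \<open>m\<close> only has to add up integrals.\<close>
  have stop: "I c m S \<le> 3/2 * measure M S + 9 / (2 * B) * (LINT x:S|M. norm (f x - c))"
    if "S \<in> D" "norm (mean_on M f S - c) \<le> 2 * B" "m \<le> n" for m S
    using that
  proof (induction m arbitrary: S)
    case 0
    have "exp (\<kappa> * norm (mean_on M f S - c)) \<le> 3/2"
      using \<kappa> 0 by (intro order_trans[OF _ small']) simp
    from mult_left_mono[OF this measure_nonneg[of M S]]
    have "I c 0 S \<le> 3/2 * measure M S"
      by (simp add: I_def mult.commute)
    moreover have "0 \<le> 9 / (2 * B) * (LINT x:S|M. norm (f x - c))"
      using assms(1) by (intro mult_nonneg_nonneg set_integral_norm_nonneg) auto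
    ultimately show ?case by linarith
  next
    case (Suc m)
    have kid: "I c m T \<le> 3/2 * measure M T + 9 / (2 * B) * (LINT x:T|M. norm (f x - c))"
      if T: "T \<in> kids S" for T
    proof (cases "norm (mean_on M f T - c) \<le> 2 * B")
      case True
      then show ?thesis using Suc T kid_cell by simp
    next
      case False
      have TD: "T \<in> D" using kid_cell Suc.prems(1) T by blast
      have "norm (mean_on M f T - mean_on M f S) \<le> N * B"
        using Suc.prems(1) T int osc assms(1) by (intro norm_mean_kid_diff_le) auto
      then have "norm (mean_on M f T - c) \<le> 2 * B + N * B"
        using Suc.prems(2) norm_triangle_ineq[of "mean_on M f T - mean_on M f S" "mean_on M f S - c"]
        by simp
      then have e: "exp (\<kappa> * norm (mean_on M f T - c)) \<le> 3/2"
        unfolding small[symmetric] using \<kappa> by simp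
      \<comment> \<open>\<open>T\<close> is a stopping cell. It lies at least one level below \<open>R\<close>, so the outer induction hypothesis
        applies to \<open>T\<close> with its own mean as centre.\<close>
      have IH: "I (mean_on M f T) m T \<le> 6 * measure M T"
        unfolding I_def using Suc.prems(3) TD by (intro less.IH) auto
      have "I c m T \<le> exp (\<kappa> * norm (mean_on M f T - c)) * (6 * measure M T)"
        using shift[OF TD] IH by (meson exp_ge_zero mult_left_mono order_trans)
      also have "\<dots> \<le> 3/2 * (6 * measure M T)"
        using e by (intro mult_right_mono) auto
      also have "\<dots> = 9 / (2 * B) * (2 * B * measure M T)" using assms(1) by simp
      also have "\<dots> \<le> 9 / (2 * B) * (LINT x:T|M. norm (f x - c))"
      proof (rule mult_left_mono)
        have "2 * B * measure M T \<le> norm (mean_on M f T - c) * measure M T"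
          using False by (intro mult_right_mono) auto
        also have "\<dots> \<le> (LINT x:T|M. norm (f x - c))"
          using TD by (intro norm_mean_on_diff_le cell_sets cell_pos int)
        finally show "2 * B * measure M T \<le> (LINT x:T|M. norm (f x - c))" .
      qed (use assms(1) in simp)
      finally show ?thesis using measure_nonneg[of M T] by linarith
    qed
    have fc: "set_integrable M S (\<lambda>x. norm (f x - c))"
      using Suc.prems(1) by (intro set_integrable_norm_diff_const cell_sets cell_pos int)
    have "I c (Suc m) S = (\<Sum>T\<in>kids S. I c m T)" by (simp add: I_def)
    also have "\<dots> \<le> (\<Sum>T\<in>kids S. 3/2 * measure M T + 9 / (2 * B) * (LINT x:T|M. norm (f x - c)))"
      by (rule sum_mono[OF kid])
    also have "\<dots> = 3/2 * measure M S + 9 / (2 * B) * (LINT x:S|M. norm (f x - c))"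
      using measure_kids[OF Suc.prems(1)] set_integral_kids[OF Suc.prems(1) fc]
      by (simp add: sum.distrib sum_distrib_left)
    finally show ?case .
  qed
  have "I c n R \<le> 3/2 * measure M R + 9 / (2 * B) * oscillation M f R"
    using stop[OF less.prems, of n] assms(1) by (simp add: c_def oscillation_def)
  also have "\<dots> \<le> 3/2 * measure M R + 9 / (2 * B) * (B * measure M R)"
    using osc[OF less.prems] assms(1) by (intro add_left_mono mult_left_mono) auto
  also have "\<dots> = 6 * measure M R" using assms(1) by simp
  finally show ?case unfolding I_def c_def .
qed

end

text \<open>
  The truncated exponential is Lipschitz with constant \<open>\<kappa> exp(\<kappa>K)\<close>.
\<close>

lemma exp_min_le_add_dist:
  fixes \<kappa> s t K :: real
  assumes "0 \<le> \<kappa>"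
  shows "exp (\<kappa> * min s K) \<le> exp (\<kappa> * min t K) + \<kappa> * exp (\<kappa> * K) * \<bar>s - t\<bar>"
proof -
  let ?x = "\<kappa> * min s K" and ?y = "\<kappa> * min t K"
  have "exp ?x * (1 + (?y - ?x)) \<le> exp ?x * exp (?y - ?x)"
    by (intro mult_left_mono) auto
  then have "exp ?x \<le> exp ?y + exp ?x * (?x - ?y)"
    by (simp add: exp_diff algebra_simps)
  also have "exp ?x * (?x - ?y) \<le> exp (\<kappa> * K) * (\<kappa> * \<bar>s - t\<bar>)"
  proof (cases "?y \<le> ?x")
    case True
    have "?x - ?y = \<kappa> * (min s K - min t K)" by (simp add: algebra_simps)
    also have "\<dots> \<le> \<kappa> * \<bar>s - t\<bar>" using assms by (intro mult_left_mono) auto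
    finally show ?thesis using True assms by (intro mult_mono) (auto intro!: mult_left_mono)
  next
    case False
    then have "exp ?x * (?x - ?y) \<le> 0" by (simp add: mult_nonneg_nonpos)
    also have "0 \<le> exp (\<kappa> * K) * (\<kappa> * \<bar>s - t\<bar>)" using assms by simp
    finally show ?thesis .
  qed
  finally show ?thesis by (simp add: algebra_simps)
qed

context splitting_family
begin

text \<open>
  Passage from the means at depth \<open>n\<close> to the function. No subsequence converging almost everywhere is
  needed: for each truncation level the error at depth \<open>n\<close> is a multiple of the sum of the oscillations
  of the leaves, which \<open>conv\<close> makes arbitrarily small.
\<close>

lemma exponential_integrability:
  fixes f :: "'a \<Rightarrow> 'b::{banach, second_countable_topology}"
  assumes "0 < B" "0 < N" and R: "R \<in> D"
    and int: "\<And>S. S \<in> D \<Longrightarrow> set_integrable M S f"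
    and osc: "\<And>S. S \<in> D \<Longrightarrow> oscillation M f S \<le> B * measure M S"
    and conv: "\<And>e. 0 < e \<Longrightarrow> \<exists>n. leaf_sum kids (oscillation M f) n R < e"
  defines "\<kappa> \<equiv> ln (3/2) / (2 + N) / B"
  shows "(\<integral>\<^sup>+x\<in>R. ennreal (exp (\<kappa> * norm (f x - mean_on M f R))) \<partial>M) \<le> ennreal (6 * measure M R)"
proof -
  have \<kappa>: "0 < \<kappa>" using assms(1,2) by (simp add: \<kappa>_def)
  define c where "c = mean_on M f R"
  define \<phi> where "\<phi> K x = exp (\<kappa> * min (norm (f x - c)) K)" for K :: real and x
  define h where "h x = indicator R x *\<^sub>R f x" for x
  have h[measurable]: "h \<in> borel_measurable M"
    using int[OF R] by (auto simp: set_integrable_def h_def[abs_def])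
  have [measurable]: "R \<in> sets M" by (rule cell_sets[OF R])
  have int_\<phi>: "set_integrable M R (\<phi> K)" for K
    unfolding set_integrable_def
  proof (rule Bochner_Integration.integrable_bound)
    show "integrable M (\<lambda>x. indicator R x *\<^sub>R exp (\<kappa> * K))"
      by (rule set_integrable_const_measure_pos[OF cell_sets[OF R] cell_pos[OF R], unfolded set_integrable_def])
    have "(\<lambda>x. indicator R x *\<^sub>R \<phi> K x)
        = (\<lambda>x. indicator R x *\<^sub>R exp (\<kappa> * min (norm (h x - c)) K))"
      by (auto simp: \<phi>_def h_def indicator_def)
    then show "(\<lambda>x. indicator R x *\<^sub>R \<phi> K x) \<in> borel_measurable M" by simp
    show "AE x in M. norm (indicator R x *\<^sub>R \<phi> K x) \<le> norm (indicator R x *\<^sub>R exp (\<kappa> * K))"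
      using \<kappa> by (intro AE_I2) (auto simp: \<phi>_def indicator_def)
  qed
  have int_\<phi>_sub: "set_integrable M T (\<phi> K)" if "T \<in> D" "T \<subseteq> R" for T K
    using that set_integrable_subset[OF int_\<phi>] cell_sets by blast
  have leaf: "(LINT x:T|M. \<phi> K x)
      \<le> measure M T * exp (\<kappa> * norm (mean_on M f T - c)) + \<kappa> * exp (\<kappa> * K) * oscillation M f T"
    if T: "T \<in> D" "T \<subseteq> R" for T K
  proof -
    let ?t = "norm (mean_on M f T - c)"
    note pos = cell_sets[OF T(1)] cell_pos[OF T(1)]
    have i1: "set_integrable M T (\<lambda>x. exp (\<kappa> * ?t))"
      by (rule set_integrable_const_measure_pos[OF pos])
    have i2: "set_integrable M T (\<lambda>x. \<kappa> * exp (\<kappa> * K) * norm (f x - mean_on M f T))"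
      by (intro set_integrable_mult_right set_integrable_norm_diff_const pos int T)
    have "(LINT x:T|M. \<phi> K x)
        \<le> (LINT x:T|M. exp (\<kappa> * ?t) + \<kappa> * exp (\<kappa> * K) * norm (f x - mean_on M f T))"
    proof (rule set_integral_mono[OF int_\<phi>_sub[OF T] set_integral_add(1)[OF i1 i2]])
      fix x
      have "\<phi> K x \<le> exp (\<kappa> * min ?t K) + \<kappa> * exp (\<kappa> * K) * \<bar>norm (f x - c) - ?t\<bar>"
        unfolding \<phi>_def using \<kappa> by (intro exp_min_le_add_dist) simp
      also have "\<bar>norm (f x - c) - ?t\<bar> \<le> norm (f x - mean_on M f T)"
        using norm_triangle_ineq3[of "f x - c" "mean_on M f T - c"] by simp
      also have "exp (\<kappa> * min ?t K) \<le> exp (\<kappa> * ?t)" using \<kappa> by simp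
      finally show "\<phi> K x \<le> exp (\<kappa> * ?t) + \<kappa> * exp (\<kappa> * K) * norm (f x - mean_on M f T)"
        using \<kappa> by (simp add: mult_left_mono)
    qed
    then show ?thesis
      using set_integral_add(2)[OF i1 i2] set_integral_const_measure_pos[OF pos, of "exp (\<kappa> * ?t)"]
      by (simp add: oscillation_def)
  qed
  have trunc: "(LINT x:R|M. \<phi> K x) \<le> 6 * measure M R" for K
  proof (rule field_le_epsilon)
    fix e :: real assume "0 < e"
    define L where "L = \<kappa> * exp (\<kappa> * K)"
    have L: "0 < L" using \<kappa> by (simp add: L_def)
    then obtain n where n: "leaf_sum kids (oscillation M f) n R < e / L"
      using conv[of "e / L"] \<open>0 < e\<close> by auto
    have "(LINT x:R|M. \<phi> K x) = leaf_sum kids (\<lambda>T. LINT x:T|M. \<phi> K x) n R"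
      using leaf_sum_set_integral[OF R int_\<phi>] by simp
    also have "\<dots> \<le> leaf_sum kids (\<lambda>T. measure M T * exp (\<kappa> * norm (mean_on M f T - c))
        + L * oscillation M f T) n R"
      unfolding L_def by (rule leaf_sum_le[OF R leaf])
    also have "\<dots> = leaf_sum kids (\<lambda>T. measure M T * exp (\<kappa> * norm (mean_on M f T - c))) n R
        + L * leaf_sum kids (oscillation M f) n R"
      by (simp add: leaf_sum_add leaf_sum_cmult)
    also have "\<dots> \<le> 6 * measure M R + e"
    proof (rule add_mono)
      show "leaf_sum kids (\<lambda>T. measure M T * exp (\<kappa> * norm (mean_on M f T - c))) n R \<le> 6 * measure M R"
        unfolding c_def \<kappa>_def by (rule leaf_sum_exp_le[OF assms(1,2) R int osc])
      show "L * leaf_sum kids (oscillation M f) n R \<le> e"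
        using n L by (simp add: pos_less_divide_eq mult.commute)
    qed
    finally show "(LINT x:R|M. \<phi> K x) \<le> 6 * measure M R + e" .
  qed
  \<comment> \<open>A version of the integrand in which \<open>f\<close> is replaced by \<open>h\<close>, because \<open>f\<close> is measurable on \<open>R\<close> only.\<close>
  define u where "u i x = ennreal (exp (\<kappa> * min (norm (h x - c)) (real i))) * indicator R x" for i :: nat and x
  have u_eq: "u i x = ennreal (indicator R x *\<^sub>R \<phi> (real i) x)" for i x
    by (auto simp: u_def \<phi>_def h_def indicator_def)
  have "ennreal (exp (\<kappa> * norm (f x - c))) * indicator R x = (SUP i. u i x)" for x
  proof (rule antisym)
    obtain i :: nat where "norm (f x - c) \<le> real i" using real_arch_simple by blast
    then have "ennreal (exp (\<kappa> * norm (f x - c))) * indicator R x = u i x"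
      by (auto simp: u_eq \<phi>_def indicator_def)
    then show "ennreal (exp (\<kappa> * norm (f x - c))) * indicator R x \<le> (SUP i. u i x)"
      by (auto intro: SUP_upper)
    show "(SUP i. u i x) \<le> ennreal (exp (\<kappa> * norm (f x - c))) * indicator R x"
      using \<kappa> by (intro SUP_least) (auto simp: u_eq \<phi>_def indicator_def intro!: ennreal_leI)
  qed
  then have "(\<integral>\<^sup>+x\<in>R. ennreal (exp (\<kappa> * norm (f x - c))) \<partial>M) = (\<integral>\<^sup>+x. (SUP i. u i x) \<partial>M)"
    by simp
  also have "\<dots> = (SUP i. \<integral>\<^sup>+x. u i x \<partial>M)"
  proof (rule nn_integral_monotone_convergence_SUP)
    show "incseq u"
      using \<kappa> by (intro incseq_SucI le_funI) (auto simp: u_def indicator_def intro!: ennreal_leI)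
    show "u i \<in> borel_measurable M" for i unfolding u_def[abs_def] by measurable
  qed
  also have "\<dots> \<le> ennreal (6 * measure M R)"
  proof (rule SUP_least)
    fix i
    have "(\<integral>\<^sup>+x. u i x \<partial>M) = ennreal (LINT x:R|M. \<phi> (real i) x)"
      unfolding u_eq set_lebesgue_integral_def using int_\<phi>[of "real i"]
      by (intro nn_integral_eq_integral) (auto simp: set_integrable_def \<phi>_def)
    then show "(\<integral>\<^sup>+x. u i x \<partial>M) \<le> ennreal (6 * measure M R)"
      using trunc[of "real i"] by (simp add: ennreal_leI)
  qed
  finally show ?thesis by (simp add: c_def)
qed

end

section \<open>Means over small cells approximate the function\<close>

lemma borel_measurable_on_if_continuous:
  fixes g :: "'a::topological_space \<Rightarrow> real"
  assumes R: "R \<in> sets M" and opn: "\<And>U. open U \<Longrightarrow> R \<inter> U \<in> sets M" and g: "continuous_on UNIV g"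
  shows "(\<lambda>x. indicator R x *\<^sub>R g x) \<in> borel_measurable M"
proof -
  have sp: "R \<subseteq> space M" using R by (rule sets.sets_into_space)
  have "g \<in> borel_measurable (restrict_space M R)"
  proof (rule borel_measurableI)
    fix S :: "real set" assume "open S"
    then have "open (g -` S)" using g by (simp add: open_vimage)
    then have "R \<inter> g -` S \<in> sets M" by (rule opn)
    moreover have "g -` S \<inter> space (restrict_space M R) = R \<inter> g -` S"
      using sp by (auto simp: space_restrict_space)
    ultimately show "g -` S \<inter> space (restrict_space M R) \<in> sets (restrict_space M R)"
      using R by (auto simp: sets_restrict_space_iff)
  qed
  then show ?thesis using R by (subst (asm) borel_measurable_restrict_space_iff) auto
qed

text \<open>
  The functions \<open>min(1, k dist(x, -U))\<close> are Lipschitz and increase to the indicator of \<open>U\<close>.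
\<close>

lemma indicator_open_approx:
  fixes U :: "'a::metric_space set"
  assumes R: "R \<in> sets M" "0 < measure M R" and opn: "\<And>U. open U \<Longrightarrow> R \<inter> U \<in> sets M"
    and U: "open U" and "0 < (e::real)"
  obtains g :: "'a \<Rightarrow> real" where "uniformly_continuous_on UNIV g" "set_integrable M R g"
    "(LINT x:R|M. \<bar>indicator U x - g x\<bar>) < e"
\<comment> \<open>The case \<open>U = UNIV\<close> is separate because \<open>infdist x {} = 0\<close>.\<close>
proof (cases "U = UNIV")
  case True
  show ?thesis
  proof (rule that[of "\<lambda>_. 1"])
    show "set_integrable M R (\<lambda>_. 1::real)" by (rule set_integrable_const_measure_pos[OF R])
  qed (use True \<open>0 < e\<close> in \<open>auto intro: uniformly_continuous_on_const\<close>)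
next
  case False
  define g where "g k x = min 1 (real k * infdist x (- U))" for k x
  have lip: "(real k)-lipschitz_on UNIV (g k)" for k
  proof (rule lipschitz_onI)
    fix x y
    have "\<bar>g k x - g k y\<bar> \<le> \<bar>real k * infdist x (- U) - real k * infdist y (- U)\<bar>"
      by (auto simp: g_def)
    also have "\<dots> = real k * \<bar>infdist x (- U) - infdist y (- U)\<bar>"
      by (simp add: abs_mult flip: right_diff_distrib)
    also have "\<dots> \<le> real k * dist x y" by (intro mult_left_mono infdist_triangle_abs) auto
    finally show "dist (g k x) (g k y) \<le> real k * dist x y" by (simp add: dist_real_def)
  qed simp
  have uc: "uniformly_continuous_on UNIV (g k)" for k
    using lip by (rule lipschitz_on_uniformly_continuous)
  have g01: "0 \<le> g k x" "g k x \<le> 1" for k x by (auto simp: g_def infdist_nonneg)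
  have meas[measurable]: "(\<lambda>x. indicator R x *\<^sub>R g k x) \<in> borel_measurable M" for k
    using uc by (intro borel_measurable_on_if_continuous R opn uniformly_continuous_imp_continuous)
  have RU: "R \<inter> U \<in> sets M" using U by (rule opn)
  have one: "integrable M (\<lambda>x. indicator R x *\<^sub>R (1::real))"
    by (rule set_integrable_const_measure_pos[OF R, unfolded set_integrable_def])
  have int: "set_integrable M R (g k)" for k
    unfolding set_integrable_def
    by (rule Bochner_Integration.integrable_bound[OF one meas])
       (use g01 in \<open>auto simp: indicator_def\<close>)
  have lim: "(\<lambda>k. g k x) \<longlonglongrightarrow> indicator U x" for x
  proof (cases "x \<in> U")
    case True
    then have "0 < infdist x (- U)"
      using U False by (intro infdist_pos_not_in_closed) auto
    then obtain k0 :: nat where k0: "1 < real k0 * infdist x (- U)"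
      using reals_Archimedean3 by blast
    have "g k x = 1" if "k \<ge> k0" for k
    proof -
      have "real k0 * infdist x (- U) \<le> real k * infdist x (- U)"
        using that by (intro mult_right_mono) (auto simp: infdist_nonneg)
      then show ?thesis using k0 by (simp add: g_def)
    qed
    then show ?thesis using True by (auto intro!: tendsto_eventually eventually_sequentiallyI[of k0])
  next
    case False
    then show ?thesis by (simp add: g_def)
  qed
  have "(\<lambda>k. LINT x|M. indicator R x *\<^sub>R \<bar>indicator U x - g k x\<bar>) \<longlonglongrightarrow> (LINT x|M. 0::real)"
  proof (rule integral_dominated_convergence[OF _ _ one])
    have "(\<lambda>x. indicator R x *\<^sub>R \<bar>indicator U x - g k x\<bar>)
        = (\<lambda>x. \<bar>indicator (R \<inter> U) x - indicator R x *\<^sub>R g k x\<bar>)" for k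
      by (auto simp: indicator_def)
    then show "(\<lambda>x. indicator R x *\<^sub>R \<bar>indicator U x - g k x\<bar>) \<in> borel_measurable M" for k
      using RU meas by (simp only:) (intro borel_measurable_abs borel_measurable_diff borel_measurable_indicator)
    show "AE x in M. (\<lambda>k. indicator R x *\<^sub>R \<bar>indicator U x - g k x\<bar>) \<longlonglongrightarrow> 0"
    proof (rule AE_I2)
      fix x
      have "(\<lambda>k. indicator R x *\<^sub>R \<bar>indicator U x - g k x\<bar>)
          \<longlonglongrightarrow> indicator R x *\<^sub>R \<bar>indicator U x - indicator U x :: real\<bar>"
        by (intro tendsto_intros lim)
      then show "(\<lambda>k. indicator R x *\<^sub>R \<bar>indicator U x - g k x\<bar>) \<longlonglongrightarrow> 0" by simp
    qed
    show "AE x in M. norm (indicator R x *\<^sub>R \<bar>indicator U x - g k x\<bar>) \<le> indicator R x *\<^sub>R 1" for k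
    proof (rule AE_I2)
      fix x
      show "norm (indicator R x *\<^sub>R \<bar>indicator U x - g k x\<bar>) \<le> indicator R x *\<^sub>R 1"
        using g01[of k x] by (auto simp: indicator_def)
    qed
  qed simp
  then have "\<forall>\<^sub>F k in sequentially. (LINT x:R|M. \<bar>indicator U x - g k x\<bar>) < e"
    using \<open>0 < e\<close> unfolding set_lebesgue_integral_def by (intro order_tendstoD(2)) auto
  then obtain k where "(LINT x:R|M. \<bar>indicator U x - g k x\<bar>) < e"
    by (auto simp: eventually_sequentially)
  then show ?thesis using uc int that by blast
qed

lemma set_integral_norm_diff_triangle:
  fixes f g h :: "'a \<Rightarrow> 'b::{banach, second_countable_topology}"
  assumes f: "set_integrable M R f" and g: "set_integrable M R g" and h: "set_integrable M R h"
  shows "(LINT x:R|M. norm (f x - h x))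
    \<le> (LINT x:R|M. norm (f x - g x)) + (LINT x:R|M. norm (g x - h x))"
proof -
  have "(LINT x:R|M. norm (f x - h x)) \<le> (LINT x:R|M. norm (f x - g x) + norm (g x - h x))"
    using assms
  proof (intro set_integral_mono)
    fix x
    show "norm (f x - h x) \<le> norm (f x - g x) + norm (g x - h x)"
      using norm_triangle_ineq[of "f x - g x" "g x - h x"] by simp
  qed (auto intro!: set_integrable_norm set_integral_diff(1) set_integral_add(1))
  also have "\<dots> = (LINT x:R|M. norm (f x - g x)) + (LINT x:R|M. norm (g x - h x))"
    using assms by (intro set_integral_add(2) set_integrable_norm set_integral_diff(1))
  finally show ?thesis .
qed

text \<open>
  Density in \<open>L\<^sup>1(R)\<close>. Measurable sets are approximated by open sets, these by Lipschitz functions, and the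
  general case follows by linearity and dominated convergence. Uniform rather than plain continuity is
  what makes oscillations over small cells small.
\<close>

lemma integrable_approx_uniformly_continuous:
  fixes f :: "'a::metric_space \<Rightarrow> 'b::{banach, second_countable_topology}"
  assumes R: "R \<in> sets M" "0 < measure M R" and opn: "\<And>U. open U \<Longrightarrow> R \<inter> U \<in> sets M"
    and outer: "\<And>A e. A \<in> sets M \<Longrightarrow> 0 < e \<Longrightarrow>
      \<exists>U. open U \<and> A \<subseteq> U \<and> measure M (R \<inter> (U - A)) < e"
    and f: "integrable M f"
  shows "\<forall>e>0. \<exists>g. uniformly_continuous_on UNIV g \<and> set_integrable M R g \<and>
      (LINT x:R|M. norm (f x - g x)) < e"
  using f
proof (induction rule: integrable_induct)
  case (base A c)
  show ?case
  proof (intro allI impI)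
    fix e :: real assume "0 < e"
    define d where "d = e / 2 / (norm c + 1)"
    have d: "0 < d" using \<open>0 < e\<close> by (simp add: d_def add_nonneg_pos)
    from outer[OF base(1) d] obtain U where U: "open U" "A \<subseteq> U" "measure M (R \<inter> (U - A)) < d"
      by blast
    from indicator_open_approx[OF R opn U(1) d] obtain g :: "'a \<Rightarrow> real"
      where g: "uniformly_continuous_on UNIV g" "set_integrable M R g"
        "(LINT x:R|M. \<bar>indicator U x - g x\<bar>) < d" .
    have one: "integrable M (\<lambda>x. indicator R x *\<^sub>R (1::real))"
      by (rule set_integrable_const_measure_pos[OF R, unfolded set_integrable_def])
    have A: "set_integrable M R (indicator A :: 'a \<Rightarrow> real)"
      unfolding set_integrable_def
      by (rule Bochner_Integration.integrable_bound[OF one])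
         (use R base in \<open>auto simp: indicator_def\<close>)
    have RU: "R \<inter> U \<in> sets M" using U(1) by (rule opn)
    have U': "set_integrable M R (indicator U :: 'a \<Rightarrow> real)"
    proof -
      have "(\<lambda>x. indicator R x *\<^sub>R (indicator U x :: real)) = indicator (R \<inter> U)"
        by (auto simp: indicator_def)
      then show ?thesis unfolding set_integrable_def
        using RU by (intro Bochner_Integration.integrable_bound[OF one]) (auto simp: indicator_def)
    qed
    have RUA: "R \<inter> (U - A) \<in> sets M"
      using RU base(1) by (metis Diff_Int_distrib Int_Diff sets.Diff)
    have "(LINT x:R|M. \<bar>indicator A x - indicator U x :: real\<bar>) = (LINT x|M. indicator (R \<inter> (U - A)) x)"
      unfolding set_lebesgue_integral_def using U(2)
      by (intro Bochner_Integration.integral_cong) (auto simp: indicator_def)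
    then have AU: "(LINT x:R|M. \<bar>indicator A x - indicator U x :: real\<bar>) < d"
      using U(3) RUA by (simp add: sets.sets_into_space Int_absorb2)
    have "(LINT x:R|M. norm (indicator A x - g x)) < 2 * d"
      using set_integral_norm_diff_triangle[OF A U' g(2)] AU g(3) by simp
    then have "norm c * (LINT x:R|M. norm (indicator A x - g x)) \<le> norm c * (2 * d)"
      by (intro mult_left_mono) auto
    also have "\<dots> < (norm c + 1) * (2 * d)" using d by simp
    also have "\<dots> = 2 * (d * (norm c + 1))" by (simp add: algebra_simps)
    also have "d * (norm c + 1) = e / 2"
      unfolding d_def using add_nonneg_pos[OF norm_ge_zero zero_less_one, of c]
      by (intro nonzero_eq_divide_eq[THEN iffD1]) auto
    also have "2 * (e / 2) = e" by simp
    finally have lt: "norm c * (LINT x:R|M. norm (indicator A x - g x)) < e" .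
    have "(LINT x:R|M. norm (indicator A x *\<^sub>R c - g x *\<^sub>R c))
        = norm c * (LINT x:R|M. norm (indicator A x - g x))"
      by (simp add: mult.commute flip: scaleR_diff_left set_integral_mult_right)
    then have "(LINT x:R|M. norm (indicator A x *\<^sub>R c - g x *\<^sub>R c)) < e" using lt by simp
    moreover have "uniformly_continuous_on UNIV (\<lambda>x. g x *\<^sub>R c)"
      using g(1) by (rule bounded_linear.uniformly_continuous_on[OF bounded_linear_scaleR_left])
    moreover have "set_integrable M R (\<lambda>x. g x *\<^sub>R c)"
      using g(2) by (intro set_integrable_scaleR_left)
    ultimately show "\<exists>g. uniformly_continuous_on UNIV g \<and> set_integrable M R g \<and>
      (LINT x:R|M. norm (indicator A x *\<^sub>R c - g x)) < e" by blast
  qed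
next
  case (add f1 f2)
  have i: "set_integrable M R f1" "set_integrable M R f2"
    unfolding set_integrable_def using add R by (auto intro: integrable_mult_indicator)
  show ?case
  proof (intro allI impI)
    fix e :: real assume "0 < e"
    then have "0 < e / 2" by simp
    with add obtain g1 g2 where
      g1: "uniformly_continuous_on UNIV g1" "set_integrable M R g1"
        "(LINT x:R|M. norm (f1 x - g1 x)) < e / 2" and
      g2: "uniformly_continuous_on UNIV g2" "set_integrable M R g2"
        "(LINT x:R|M. norm (f2 x - g2 x)) < e / 2" by meson
    have "(LINT x:R|M. norm ((f1 x + f2 x) - (g1 x + g2 x)))
        \<le> (LINT x:R|M. norm (f1 x - g1 x) + norm (f2 x - g2 x))"
      using i g1 g2
      by (intro set_integral_mono set_integral_add(1) set_integrable_norm set_integral_diff(1))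
         (auto simp: norm_diff_triangle_ineq)
    also have "\<dots> = (LINT x:R|M. norm (f1 x - g1 x)) + (LINT x:R|M. norm (f2 x - g2 x))"
      using i g1 g2 by (intro set_integral_add(2) set_integrable_norm set_integral_diff(1))
    also have "\<dots> < e" using g1 g2 by simp
    finally have "(LINT x:R|M. norm ((f1 x + f2 x) - (g1 x + g2 x))) < e" .
    moreover have "uniformly_continuous_on UNIV (\<lambda>x. g1 x + g2 x)"
      by (intro uniformly_continuous_on_add g1 g2)
    moreover have "set_integrable M R (\<lambda>x. g1 x + g2 x)"
      by (intro set_integral_add(1) g1 g2)
    ultimately show "\<exists>g. uniformly_continuous_on UNIV g \<and> set_integrable M R g \<and>
      (LINT x:R|M. norm (f1 x + f2 x - g x)) < e" by blast
  qed
next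
  case (lim f s)
  have lim_bound: "norm (s k x) \<le> 2 * norm (f x)" if "x \<in> space M" for x k
    using that by (rule lim)
  have i: "set_integrable M R f" "set_integrable M R (s k)" for k
    unfolding set_integrable_def using lim R by (auto intro: integrable_mult_indicator)
  have [measurable]: "R \<in> sets M" "f \<in> borel_measurable M" "s k \<in> borel_measurable M" for k
    using lim R by auto
  have "(\<lambda>k. LINT x|M. indicator R x *\<^sub>R norm (f x - s k x)) \<longlonglongrightarrow> (LINT x|M. 0::real)"
  proof (rule integral_dominated_convergence)
    show "integrable M (\<lambda>x. 3 * norm (f x))" using lim by simp
    show "AE x in M. (\<lambda>k. indicator R x *\<^sub>R norm (f x - s k x)) \<longlonglongrightarrow> 0"
    proof (rule AE_I2)
      fix x assume "x \<in> space M"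
      then have "(\<lambda>k. indicator R x *\<^sub>R norm (f x - s k x)) \<longlonglongrightarrow> indicator R x *\<^sub>R norm (f x - f x)"
        by (intro tendsto_intros lim)
      then show "(\<lambda>k. indicator R x *\<^sub>R norm (f x - s k x)) \<longlonglongrightarrow> 0" by simp
    qed
    show "AE x in M. norm (indicator R x *\<^sub>R norm (f x - s k x)) \<le> 3 * norm (f x)" for k
    proof (rule AE_I2)
      fix x assume "x \<in> space M"
      then show "norm (indicator R x *\<^sub>R norm (f x - s k x)) \<le> 3 * norm (f x)"
        using lim_bound[of x k] norm_triangle_ineq4[of "f x" "s k x"] by (auto simp: indicator_def)
    qed
  qed auto
  then have lim0: "(\<lambda>k. LINT x:R|M. norm (f x - s k x)) \<longlonglongrightarrow> 0"
    by (simp add: set_lebesgue_integral_def)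
  show ?case
  proof (intro allI impI)
    fix e :: real assume "0 < e"
    then have e2: "0 < e / 2" by simp
    from order_tendstoD(2)[OF lim0 e2] obtain k where k: "(LINT x:R|M. norm (f x - s k x)) < e / 2"
      by (auto simp: eventually_sequentially)
    from lim.IH[of k] e2 obtain g where
      g: "uniformly_continuous_on UNIV g" "set_integrable M R g"
        "(LINT x:R|M. norm (s k x - g x)) < e / 2" by blast
    then have "(LINT x:R|M. norm (f x - g x)) < e"
      using set_integral_norm_diff_triangle[OF i(1) i(2)[of k] g(2)] k by simp
    then show "\<exists>g. uniformly_continuous_on UNIV g \<and> set_integrable M R g \<and>
      (LINT x:R|M. norm (f x - g x)) < e" using g by blast
  qed
qed

text \<open>
  Adds what is needed for the means over the cells of generation \<open>n\<close> to approximate \<open>f\<close>: outer regularity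
  inside each cell, and cells of uniformly small diameter in some generation.
\<close>

locale metric_splitting_family = splitting_family M D kids N
  for M :: "'a::metric_space measure" and D kids N +
  assumes open_Int_cell: "S \<in> D \<Longrightarrow> open U \<Longrightarrow> S \<inter> U \<in> sets M"
    and outer_open: "S \<in> D \<Longrightarrow> A \<in> sets M \<Longrightarrow> 0 < e \<Longrightarrow>
           \<exists>U. open U \<and> A \<subseteq> U \<and> measure M (S \<inter> (U - A)) < e"
    and mesh: "S \<in> D \<Longrightarrow> 0 < \<delta> \<Longrightarrow>
           \<exists>n. \<forall>T\<in>generation kids n S. \<forall>x\<in>T. \<forall>y\<in>T. dist x y < \<delta>"
begin

lemma leaf_sum_oscillation_small:
  fixes f :: "'a \<Rightarrow> 'b::{banach, second_countable_topology}"
  assumes R: "R \<in> D" and f: "set_integrable M R f" and "0 < e"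
  shows "\<exists>n. leaf_sum kids (oscillation M f) n R < e"
proof -
  note RM = cell_sets[OF R] cell_pos[OF R]
  have "0 < e / 4" using \<open>0 < e\<close> by simp
  then obtain g where uc: "uniformly_continuous_on UNIV g" and g: "set_integrable M R g"
    and fg: "(LINT x:R|M. norm (indicator R x *\<^sub>R f x - g x)) < e / 4"
    using integrable_approx_uniformly_continuous[OF RM open_Int_cell[OF R] outer_open[OF R]
        f[unfolded set_integrable_def]] by blast
  have fg: "(LINT x:R|M. norm (f x - g x)) < e / 4"
  proof -
    have "(LINT x:R|M. norm (indicator R x *\<^sub>R f x - g x)) = (LINT x:R|M. norm (f x - g x))"
      unfolding set_lebesgue_integral_def by (intro Bochner_Integration.integral_cong) (auto simp: indicator_def)
    then show ?thesis using fg by simp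
  qed
  \<comment> \<open>The oscillation of \<open>g\<close> then contributes \<open>e/2\<close> in total, and the error \<open>f - g\<close> twice \<open>e/4\<close>.\<close>
  define e' where "e' = e / (2 * measure M R)"
  have "0 < e'" using \<open>0 < e\<close> cell_pos[OF R] by (simp add: e'_def)
  with uc obtain \<delta> where "0 < \<delta>" and \<delta>: "\<And>x y. dist x y < \<delta> \<Longrightarrow> dist (g x) (g y) < e'"
    unfolding uniformly_continuous_on_def by (metis UNIV_I)
  with mesh[OF R] obtain n where
    n: "\<And>T x y. T \<in> generation kids n R \<Longrightarrow> x \<in> T \<Longrightarrow> y \<in> T \<Longrightarrow> dist x y < \<delta>"
    by meson
  have fg_int: "set_integrable M R (\<lambda>x. norm (f x - g x))"
    by (intro set_integrable_norm set_integral_diff(1) f g)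
  have "leaf_sum kids (oscillation M f) n R
      \<le> leaf_sum kids (\<lambda>T. e' * measure M T + 2 * (LINT x:T|M. norm (f x - g x))) n R"
  proof (rule leaf_sum_le[OF R])
    fix T assume T: "T \<in> D" "T \<in> generation kids n R" "T \<subseteq> R"
    have i: "set_integrable M T f" "set_integrable M T g"
      using set_integrable_subset[OF f] set_integrable_subset[OF g] T cell_sets by auto
    have "oscillation M f T \<le> oscillation M g T + 2 * (LINT x:T|M. norm (f x - g x))"
      by (rule oscillation_le_add_dist[OF cell_sets[OF T(1)] cell_pos[OF T(1)] i])
    also have "oscillation M g T \<le> e' * measure M T"
    proof (rule oscillation_le_if_dist_le[OF cell_sets[OF T(1)] cell_pos[OF T(1)] i(2)])
      fix x y assume "x \<in> T" "y \<in> T"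
      then show "norm (g x - g y) \<le> e'"
        using \<delta>[OF n[OF T(2)], of x y] by (simp add: dist_norm)
    qed
    finally show "oscillation M f T \<le> e' * measure M T + 2 * (LINT x:T|M. norm (f x - g x))" by simp
  qed
  also have "\<dots> = e' * measure M R + 2 * (LINT x:R|M. norm (f x - g x))"
    by (simp add: leaf_sum_add leaf_sum_cmult leaf_sum_measure[OF R] leaf_sum_set_integral[OF R fg_int])
  also have "\<dots> < e / 2 + 2 * (e / 4)"
    using fg cell_pos[OF R] by (simp add: e'_def)
  finally show ?thesis by auto
qed

theorem John_Nirenberg:
  fixes f :: "'a \<Rightarrow> 'b::{banach, second_countable_topology}"
  assumes "0 < B" "0 < N" and R: "R \<in> D"
    and int: "\<And>S. S \<in> D \<Longrightarrow> set_integrable M S f"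
    and osc: "\<And>S. S \<in> D \<Longrightarrow> oscillation M f S \<le> B * measure M S"
  shows "(\<integral>\<^sup>+x\<in>R. ennreal (exp (ln (3/2) / (2 + N) / B * norm (f x - mean_on M f R))) \<partial>M)
    \<le> ennreal (6 * measure M R)"
  using assms leaf_sum_oscillation_small[OF R int[OF R]] by (intro exponential_integrability) auto

end

section \<open>The right Haar measure of a box\<close>

lemma axb_carrier_lebesgue: "axb_carrier \<in> sets (lebesgue :: ((real ^ 'n) \<times> real) measure)"
proof -
  have "open (axb_carrier :: ((real ^ 'n) \<times> real) set)"
    unfolding axb_carrier_def by (intro open_Times) auto
  then show ?thesis by (intro sets_completionI_sets) auto
qed

lemma sets_axb_rho: "A \<in> sets axb_rho \<longleftrightarrow> A \<in> sets lebesgue \<and> A \<subseteq> axb_carrier"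
  by (simp add: axb_rho_def sets_restrict_space_iff axb_carrier_lebesgue conj_commute)

lemma density_axb_rho_measurable:
  "(\<lambda>(x, a). ennreal (1 / a)) \<in> borel_measurable (restrict_space lebesgue (axb_carrier :: ((real ^ 'n) \<times> real) set))"
proof -
  have "(\<lambda>p. ennreal (1 / snd p)) \<in> borel_measurable (borel :: ((real ^ 'n) \<times> real) measure)"
    unfolding borel_prod[symmetric] by measurable
  then have "(\<lambda>p. ennreal (1 / snd p)) \<in> borel_measurable (lebesgue :: ((real ^ 'n) \<times> real) measure)"
    by (intro measurable_completion) simp
  then show ?thesis
    by (intro measurable_restrict_space1) (simp add: case_prod_beta)
qed

lemma emeasure_axb_rho:
  assumes "A \<in> sets lebesgue" "A \<subseteq> axb_carrier"
  shows "emeasure axb_rho A = (\<integral>\<^sup>+p. ennreal (1 / snd p) * indicator A p \<partial>lebesgue)"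
proof -
  have "A \<in> sets (restrict_space lebesgue axb_carrier)"
    using assms by (simp add: sets_restrict_space_iff axb_carrier_lebesgue)
  then have "emeasure axb_rho A
      = (\<integral>\<^sup>+p. (ennreal (1 / snd p) * indicator A p) \<partial>restrict_space lebesgue axb_carrier)"
    unfolding axb_rho_def by (simp add: emeasure_density[OF density_axb_rho_measurable] case_prod_beta)
  also have "\<dots> = (\<integral>\<^sup>+p. (ennreal (1 / snd p) * indicator A p) * indicator axb_carrier p \<partial>lebesgue)"
    using axb_carrier_lebesgue by (intro nn_integral_restrict_space) auto
  also have "\<dots> = (\<integral>\<^sup>+p. ennreal (1 / snd p) * indicator A p \<partial>lebesgue)"
    using assms(2) by (intro nn_integral_cong) (auto simp: indicator_def)
  finally show ?thesis .
qed

lemma Times_Icc_axb: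
  assumes A: "A \<in> sets borel" and u: "0 < u"
  shows "A \<times> {u..v} \<in> sets (lebesgue :: ((real ^ 'n) \<times> real) measure)" "A \<times> {u..v} \<subseteq> axb_carrier"
proof -
  have "A \<times> {u..v} \<in> sets borel" using A by (intro borel_Times) auto
  then show "A \<times> {u..v} \<in> sets lebesgue" by (intro sets_completionI_sets) simp
  show "A \<times> {u..v} \<subseteq> axb_carrier" using u by (auto simp: axb_carrier_def)
qed

text \<open>
  By Tonelli. In the second variable the measure is Lebesgue measure on the logarithmic scale.
\<close>

lemma emeasure_axb_rho_Times_Icc:
  assumes A: "A \<in> sets borel" and u: "0 < u" and uv: "u \<le> v"
  shows "emeasure axb_rho (A \<times> {u..v} :: ((real ^ 'n) \<times> real) set) = emeasure lborel A * ennreal (ln v - ln u)"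
proof -
  let ?f = "\<lambda>p :: (real ^ 'n) \<times> real. ennreal (1 / snd p) * indicator (A \<times> {u..v}) p"
  have [measurable]: "A \<times> {u..v} \<in> sets (lborel \<Otimes>\<^sub>M lborel)"
    using A by (intro pair_measureI) auto
  have "emeasure axb_rho (A \<times> {u..v}) = (\<integral>\<^sup>+p. ?f p \<partial>lborel)"
    using Times_Icc_axb[OF A u] by (simp add: emeasure_axb_rho nn_integral_completion)
  also have "\<dots> = (\<integral>\<^sup>+p. ?f p \<partial>(lborel \<Otimes>\<^sub>M lborel))"
    by (simp add: lborel_prod)
  also have "\<dots> = (\<integral>\<^sup>+x. \<integral>\<^sup>+a. ?f (x, a) \<partial>lborel \<partial>lborel)"
    by (rule lborel.nn_integral_fst[symmetric]) measurable
  also have "\<dots> = (\<integral>\<^sup>+x. ennreal (ln v - ln u) * indicator A x \<partial>lborel)"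
  proof (rule nn_integral_cong)
    fix x
    have "(\<integral>\<^sup>+a. ?f (x, a) \<partial>lborel) = (\<integral>\<^sup>+a. indicator A x * (ennreal (1 / a) * indicator {u..v} a) \<partial>lborel)"
      by (intro nn_integral_cong) (auto simp: indicator_def)
    also have "\<dots> = indicator A x * (\<integral>\<^sup>+a. ennreal (1 / a) * indicator {u..v} a \<partial>lborel)"
      by (rule nn_integral_cmult) measurable
    also have "(\<integral>\<^sup>+a. ennreal (1 / a) * indicator {u..v} a \<partial>lborel) = ennreal (ln v - ln u)"
    proof (rule nn_integral_FTC_Icc[OF _ _ _ uv])
      show "(ln has_real_derivative 1 / a) (at a)" if "a \<in> {u..v}" for a
        using that u by (auto intro!: derivative_eq_intros)
    qed (use u in auto)
    finally show "(\<integral>\<^sup>+a. ?f (x, a) \<partial>lborel) = ennreal (ln v - ln u) * indicator A x"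
      by (simp add: mult.commute)
  qed
  also have "\<dots> = ennreal (ln v - ln u) * emeasure lborel A"
    using A by (intro nn_integral_cmult_indicator) simp
  finally show ?thesis by (simp add: mult.commute)
qed

text \<open>
  Away from the boundary \<open>a = 0\<close>, the Haar measure inherits the outer regularity of Lebesgue measure
  through this bound.
\<close>

lemma emeasure_axb_rho_le_lebesgue:
  assumes A: "A \<in> sets lebesgue" "A \<subseteq> UNIV \<times> {\<alpha>..}" and "0 < \<alpha>"
  shows "emeasure axb_rho A \<le> ennreal (1 / \<alpha>) * emeasure lebesgue A"
proof -
  have "A \<subseteq> axb_carrier" using A(2) \<open>0 < \<alpha>\<close> by (auto simp: axb_carrier_def)
  then have "emeasure axb_rho A = (\<integral>\<^sup>+p. ennreal (1 / snd p) * indicator A p \<partial>lebesgue)"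
    using A(1) by (intro emeasure_axb_rho)
  also have "\<dots> \<le> (\<integral>\<^sup>+p. ennreal (1 / \<alpha>) * indicator A p \<partial>lebesgue)"
    using A(2) \<open>0 < \<alpha>\<close>
    by (intro nn_integral_mono) (auto simp: indicator_def intro!: ennreal_leI divide_left_mono)
  also have "\<dots> = ennreal (1 / \<alpha>) * emeasure lebesgue A"
    using A(1) by (intro nn_integral_cmult_indicator)
  finally show ?thesis .
qed

section \<open>Dyadic cubes\<close>

lemma dyadic_cube_borel: "dyadic_cube k m \<in> sets borel"
  unfolding dyadic_cube_def by measurable

lemma box_subset_dyadic_cube:
  "box (\<chi> i. 2 powi k * of_int (m i)) (\<chi> i. 2 powi k * (of_int (m i) + 1)) \<subseteq> dyadic_cube k m"
  and dyadic_cube_subset_cbox: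
  "dyadic_cube k m \<subseteq> cbox (\<chi> i. 2 powi k * of_int (m i)) (\<chi> i. 2 powi k * (of_int (m i) + 1))"
  by (auto simp: dyadic_cube_def mem_box_cart less_imp_le)

lemma emeasure_dyadic_cube:
  "emeasure lborel (dyadic_cube k m :: (real ^ 'n) set) = ennreal ((2 powi k) ^ CARD('n))"
proof -
  let ?u = "(\<chi> i. 2 powi k * of_int (m i)) :: real ^ 'n"
  let ?v = "(\<chi> i. 2 powi k * (of_int (m i) + 1)) :: real ^ 'n"
  have le: "?u \<bullet> b \<le> ?v \<bullet> b" if "b \<in> Basis" for b
    using that by (auto simp: Basis_vec_def inner_axis)
  have ne: "cbox ?u ?v \<noteq> {}" using le by (simp add: box_ne_empty)
  have "emeasure lborel (cbox ?u ?v) = ennreal (measure lborel (cbox ?u ?v))"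
    by (rule emeasure_eq_ennreal_measure) (metis emeasure_lborel_cbox_finite less_top infinity_ennreal_def)
  also have "measure lborel (cbox ?u ?v) = (2 powi k) ^ CARD('n)"
    using content_cbox_cart[OF ne] by (simp add: algebra_simps)
  finally have c: "emeasure lborel (cbox ?u ?v) = ennreal ((2 powi k) ^ CARD('n))" .
  have "emeasure lborel (box ?u ?v) = emeasure lborel (cbox ?u ?v)"
    using le by simp
  moreover have "emeasure lborel (box ?u ?v) \<le> emeasure lborel (dyadic_cube k m)"
    by (intro emeasure_mono box_subset_dyadic_cube) (simp add: dyadic_cube_borel)
  moreover have "emeasure lborel (dyadic_cube k m) \<le> emeasure lborel (cbox ?u ?v)"
    by (intro emeasure_mono dyadic_cube_subset_cbox) simp
  ultimately show ?thesis using c by simp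
qed

lemma dyadic_cube_disjoint:
  assumes "x \<in> dyadic_cube k m" "x \<in> dyadic_cube k m'"
  shows "m = m'"
proof -
  have le: "p i \<le> q i" if "x \<in> dyadic_cube k p" "x \<in> dyadic_cube k q" for p q i
  proof -
    have "2 powi k * of_int (p i) \<le> x $ i" "x $ i < 2 powi k * (of_int (q i) + 1)"
      using that by (auto simp: dyadic_cube_def)
    then have "(2::real) powi k * of_int (p i) < 2 powi k * (of_int (q i) + 1)"
      by (rule le_less_trans)
    then have "real_of_int (p i) < of_int (q i) + 1"
      by (rule mult_left_less_imp_less) simp
    then show ?thesis by linarith
  qed
  show ?thesis using le[OF assms] le[OF assms(2,1)] by (auto intro!: ext antisym)
qed

text \<open>
  The set \<open>J\<close> collects the coordinates in which the upper half is taken.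
\<close>

lemma dyadic_cube_subdivision:
  "dyadic_cube k m = (\<Union>J. dyadic_cube (k - 1) (\<lambda>i. 2 * m i + of_bool (i \<in> J)))"
proof -
  define L :: real where "L = 2 powi (k - 1)"
  have L: "0 < L" by (simp add: L_def)
  have k: "2 powi k = 2 * L" using power_int_add[of "2::real" 1 "k - 1"] by (simp add: L_def)
  show ?thesis
  proof (intro set_eqI iffI)
    fix x assume x: "x \<in> dyadic_cube k m"
    have "x \<in> dyadic_cube (k - 1) (\<lambda>i. 2 * m i + of_bool (i \<in> {i. L * (2 * of_int (m i) + 1) \<le> x $ i}))"
      using x by (auto simp: dyadic_cube_def k L_def[symmetric] algebra_simps of_bool_def)
    then show "x \<in> (\<Union>J. dyadic_cube (k - 1) (\<lambda>i. 2 * m i + of_bool (i \<in> J)))" by blast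
  next
    fix x assume "x \<in> (\<Union>J. dyadic_cube (k - 1) (\<lambda>i. 2 * m i + of_bool (i \<in> J)))"
    then obtain J where x: "\<And>i. L * (2 * of_int (m i) + of_bool (i \<in> J)) \<le> x $ i"
      "\<And>i. x $ i < L * (2 * of_int (m i) + of_bool (i \<in> J) + 1)"
      by (auto simp: dyadic_cube_def L_def)
    have "2 * L * of_int (m i) \<le> x $ i \<and> x $ i < 2 * L * (of_int (m i) + 1)" for i
      using x[of i] L by (cases "i \<in> J") (auto simp: algebra_simps)
    then show "x \<in> dyadic_cube k m" by (simp add: dyadic_cube_def k)
  qed
qed

section \<open>Splitting of Calderon-Zygmund sets\<close>

definition CZ_box :: "int \<Rightarrow> ('n \<Rightarrow> int) \<Rightarrow> real \<Rightarrow> real \<Rightarrow> ((real ^ 'n) \<times> real) set" where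
  "CZ_box k m a r = dyadic_cube k m \<times> {a * exp (- r)..a * exp r}"

lemma CZ_setsI: "0 < a \<Longrightarrow> 0 < r \<Longrightarrow> CZ_admissible (2 powi k) a r \<Longrightarrow> CZ_box k m a r \<in> CZ_sets"
  unfolding CZ_sets_def CZ_box_def by blast

lemma CZ_setsE:
  assumes "R \<in> CZ_sets"
  obtains k m a r where "R = CZ_box k m a r" "0 < a" "0 < r" "CZ_admissible (2 powi k) a r"
  using assms unfolding CZ_sets_def CZ_box_def by blast

lemma CZ_box_sets: "0 < a \<Longrightarrow> CZ_box k m a r \<in> sets axb_rho"
  unfolding CZ_box_def sets_axb_rho
  using Times_Icc_axb[OF dyadic_cube_borel[of k m], of "a * exp (- r)" "a * exp r"] by simp

lemma measure_CZ_box: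
  assumes "0 < a" "0 < r"
  shows "measure axb_rho (CZ_box k m a r :: ((real ^ 'n) \<times> real) set) = (2 powi k) ^ CARD('n) * (2 * r)"
proof -
  have "emeasure axb_rho (CZ_box k m a r :: ((real ^ 'n) \<times> real) set)
      = ennreal ((2 powi k) ^ CARD('n)) * ennreal (2 * r)"
    unfolding CZ_box_def using assms
    by (subst emeasure_axb_rho_Times_Icc) (auto simp: dyadic_cube_borel emeasure_dyadic_cube ln_mult)
  then show ?thesis using assms by (simp add: measure_def ennreal_mult[symmetric])
qed

text \<open>
  With \<open>t = r/2\<close> or \<open>t = -r/2\<close>, \<open>a exp t\<close> is the logarithmic midpoint of one half of the interval. By \<open>thin\<close>,
  \<open>L\<close> is within a factor \<open>2\<close> of the admissible lower bound for \<open>(a, r)\<close>, so it suffices to place this whole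
  range between the bounds for \<open>(a exp t, r/2)\<close>. The case \<open>1 \<le> r < 2\<close> crosses between the two forms of the
  admissibility condition; there the lower bound comes down to \<open>r/2 \<le> 3r/2 - 1\<close>, with equality at \<open>r = 1\<close>.
\<close>

lemma CZ_admissible_halve_radius:
  assumes adm: "CZ_admissible L a r" and a: "0 < a" and r: "0 < r"
    and thin: "L / 2 < (if r < 1 then exp 2 * a * r else a * exp (2 * r))"
    and t: "\<bar>t\<bar> = r / 2"
  shows "CZ_admissible L (a * exp t) (r / 2)"
proof -
  have key: "?thesis" if
    "(if r / 2 < 1 then exp 2 * (a * exp t) * (r / 2) else a * exp t * exp r)
       \<le> (if r < 1 then exp 2 * a * r else a * exp (2 * r))"
    "2 * (if r < 1 then exp 2 * a * r else a * exp (2 * r))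
       \<le> (if r / 2 < 1 then exp 8 * (a * exp t) * (r / 2) else a * exp t * exp (4 * r))"
  proof -
    have "(if r < 1 then exp 2 * a * r else a * exp (2 * r)) \<le> L"
      using adm by (simp add: CZ_admissible_def split: if_splits)
    then show ?thesis
      using that thin unfolding CZ_admissible_def
      by (cases "r / 2 < 1") (simp_all only: if_True if_False, auto)
  qed
  consider "r < 1" | "1 \<le> r" "r < 2" | "2 \<le> r" by linarith
  then show ?thesis
  proof cases
    case 1
    have "exp t \<le> 2" using exp_bound_half[of t] t 1 by simp
    then have lower: "exp 2 * (a * exp t) * (r / 2) \<le> exp 2 * a * r"
      using a r by (simp add: field_simps)
    have "4 \<le> exp (6 + t)" using exp_ge_add_one_self[of "6 + t"] t 1 by linarith
    then have "exp 2 * a * r * 4 \<le> exp 2 * a * r * exp (6 + t)"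
      using a r by (intro mult_left_mono) auto
    also have "\<dots> = exp 8 * a * exp t * r" by (simp flip: exp_add add: algebra_simps)
    finally have "2 * (exp 2 * a * r) \<le> exp 8 * (a * exp t) * (r / 2)" by simp
    then show ?thesis using 1 lower by (intro key) simp_all
  next
    case 2
    have "r / 2 \<le> exp (2 * r - 2 - t)" using exp_ge_add_one_self[of "2 * r - 2 - t"] t 2 by linarith
    then have "a * exp (2 + t) * (r / 2) \<le> a * exp (2 + t) * exp (2 * r - 2 - t)"
      using a by (intro mult_left_mono) auto
    also have "\<dots> = a * exp (2 * r)" by (simp flip: exp_add add: algebra_simps)
    finally have lower: "exp 2 * (a * exp t) * (r / 2) \<le> a * exp (2 * r)"
      by (simp add: exp_add algebra_simps)
    have "4 \<le> exp (8 + t - 2 * r)" using exp_ge_add_one_self[of "8 + t - 2 * r"] t 2 by linarith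
    then have "4 * 1 \<le> exp (8 + t - 2 * r) * r" using 2 by (intro mult_mono) auto
    then have "a * exp (2 * r) * 4 \<le> a * exp (2 * r) * (exp (8 + t - 2 * r) * r)"
      using a by (intro mult_left_mono) auto
    also have "\<dots> = exp 8 * a * exp t * r"
      by (simp flip: exp_add add: algebra_simps)
    finally have "2 * (a * exp (2 * r)) \<le> exp 8 * (a * exp t) * (r / 2)" by simp
    then show ?thesis using 2 lower by (intro key) simp_all
  next
    case 3
    have lower: "a * exp t * exp r \<le> a * exp (2 * r)"
      using a t 3 by (simp flip: exp_add add: mult.assoc)
    have "2 \<le> exp (t + 2 * r)" using exp_ge_add_one_self[of "t + 2 * r"] t 3 by linarith
    then have "a * exp (2 * r) * 2 \<le> a * exp (2 * r) * exp (t + 2 * r)"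
      using a by (intro mult_left_mono) auto
    also have "\<dots> = a * exp t * exp (4 * r)" by (simp flip: exp_add add: algebra_simps)
    finally have "2 * (a * exp (2 * r)) \<le> a * exp t * exp (4 * r)" by simp
    then show ?thesis using 3 lower by (intro key) simp_all
  qed
qed

text \<open>
  The measure of the children is bounded on both sides: the bound with \<open>2\<^sup>d\<close> is the doubling property, and the
  bound with \<open>2\<close> makes the cells shrink.
\<close>

lemma CZ_set_split:
  fixes R :: "((real ^ 'n) \<times> real) set"
  assumes "R \<in> CZ_sets"
  shows "\<exists>K. finite K \<and> K \<subseteq> CZ_sets \<and> \<Union>K = R \<and>
    (\<forall>T\<in>K. \<forall>T'\<in>K. T \<noteq> T' \<longrightarrow> (AE x in axb_rho. \<not> (x \<in> T \<and> x \<in> T'))) \<and>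
    (\<forall>T\<in>K. measure axb_rho R \<le> 2 ^ CARD('n) * measure axb_rho T \<and>
      2 * measure axb_rho T \<le> measure axb_rho R)"
proof -
  obtain k m a r where R: "R = CZ_box k m a r" and ar: "0 < a" "0 < r"
    and adm: "CZ_admissible (2 powi k) a r" using assms by (rule CZ_setsE)
  have N2: "(2::real) \<le> 2 ^ CARD('n)" by (simp add: self_le_power)
  define L :: real where "L = 2 powi (k - 1)"
  have L: "0 < L" by (simp add: L_def)
  have k: "2 powi k = 2 * L" using power_int_add[of "2::real" 1 "k - 1"] by (simp add: L_def)
  show ?thesis
  proof (cases "(if r < 1 then exp 2 * a * r else a * exp (2 * r)) \<le> 2 powi k / 2")
    case True
    define Q where "Q J = CZ_box (k - 1) (\<lambda>i. 2 * m i + of_bool (i \<in> J)) a r" for J :: "'n set"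
    have "CZ_admissible L a r"
      using adm True L by (auto simp: CZ_admissible_def k split: if_splits)
    have size: "measure axb_rho R \<le> 2 ^ CARD('n) * measure axb_rho T \<and>
      2 * measure axb_rho T \<le> measure axb_rho R" if "T \<in> range Q" for T
    proof -
      have T: "measure axb_rho T = L ^ CARD('n) * (2 * r)"
        using that ar by (auto simp: Q_def measure_CZ_box L_def)
      have RR: "measure axb_rho R = 2 ^ CARD('n) * measure axb_rho T"
        using ar by (simp add: R measure_CZ_box T k power_mult_distrib)
      show ?thesis unfolding RR using mult_right_mono[OF N2 measure_nonneg[of axb_rho T]] by simp
    qed
    show ?thesis
    proof (intro exI[of _ "range Q"] conjI ballI impI)
      show "range Q \<subseteq> CZ_sets"
        using ar \<open>CZ_admissible L a r\<close> by (auto simp: Q_def L_def intro!: CZ_setsI)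
      show "finite (range Q)" by simp
      show "\<Union>(range Q) = R"
        unfolding R Q_def CZ_box_def by (subst dyadic_cube_subdivision[of k m]) auto
      show "AE x in axb_rho. \<not> (x \<in> T \<and> x \<in> T')"
        if "T \<in> range Q" "T' \<in> range Q" "T \<noteq> T'" for T T'
      proof (rule AE_I2)
        fix x show "\<not> (x \<in> T \<and> x \<in> T')"
          using that by (auto simp: Q_def CZ_box_def dest: dyadic_cube_disjoint)
      qed
      show "measure axb_rho R \<le> 2 ^ CARD('n) * measure axb_rho T"
        "2 * measure axb_rho T \<le> measure axb_rho R" if "T \<in> range Q" for T
        using size[OF that] by auto
    qed
  next
    case False
    define H where "H t = CZ_box k m (a * exp t) (r / 2)" for t
    have adm': "CZ_admissible (2 powi k) (a * exp t) (r / 2)" if "\<bar>t\<bar> = r / 2" for t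
      using CZ_admissible_halve_radius[OF adm ar _ that] False by linarith
    let ?K = "{H (- (r / 2)), H (r / 2)}"
    have lo: "H (- (r / 2)) = dyadic_cube k m \<times> {a * exp (- r)..a}"
      by (simp add: H_def CZ_box_def mult.assoc flip: exp_add)
    have hi: "H (r / 2) = dyadic_cube k m \<times> {a..a * exp r}"
      by (simp add: H_def CZ_box_def mult.assoc flip: exp_add)
    have null: "AE x in axb_rho. \<not> (x \<in> H (- (r / 2)) \<and> x \<in> H (r / 2))"
    proof (rule AE_I')
      have "emeasure axb_rho (dyadic_cube k m \<times> {a..a}) = 0"
        using ar by (subst emeasure_axb_rho_Times_Icc) (auto simp: dyadic_cube_borel)
      then show "dyadic_cube k m \<times> {a..a} \<in> null_sets axb_rho"
        using Times_Icc_axb[OF dyadic_cube_borel ar(1), of k m a] by (auto simp: null_sets_def sets_axb_rho)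
    qed (auto simp: lo hi)
    have size: "measure axb_rho R \<le> 2 ^ CARD('n) * measure axb_rho T \<and>
      2 * measure axb_rho T \<le> measure axb_rho R" if "T \<in> ?K" for T
    proof -
      have RR: "measure axb_rho R = 2 * measure axb_rho T"
        using that ar by (auto simp: H_def R measure_CZ_box)
      show ?thesis unfolding RR using mult_right_mono[OF N2 measure_nonneg[of axb_rho T]] by simp
    qed
    show ?thesis
    proof (intro exI[of _ ?K] conjI ballI impI)
      show "?K \<subseteq> CZ_sets"
        using ar adm' by (auto simp: H_def intro!: CZ_setsI)
      show "finite ?K" by simp
      show "\<Union>?K = R"
      proof -
        have "{a * exp (- r)..a} \<union> {a..a * exp r} = {a * exp (- r)..a * exp r}"
          using ar by (intro ivl_disj_un_two_touch) auto
        then show ?thesis unfolding R lo hi CZ_box_def by auto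
      qed
      show "AE x in axb_rho. \<not> (x \<in> T \<and> x \<in> T')" if "T \<in> ?K" "T' \<in> ?K" "T \<noteq> T'" for T T'
        using that null by (auto simp: conj_commute)
      show "measure axb_rho R \<le> 2 ^ CARD('n) * measure axb_rho T"
        "2 * measure axb_rho T \<le> measure axb_rho R" if "T \<in> ?K" for T
        using size[OF that] by auto
    qed
  qed
qed

definition CZ_kids :: "((real ^ 'n) \<times> real) set \<Rightarrow> ((real ^ 'n) \<times> real) set set" where
  "CZ_kids R = (SOME K. finite K \<and> K \<subseteq> CZ_sets \<and> \<Union>K = R \<and>
    (\<forall>T\<in>K. \<forall>T'\<in>K. T \<noteq> T' \<longrightarrow> (AE x in axb_rho. \<not> (x \<in> T \<and> x \<in> T'))) \<and>
    (\<forall>T\<in>K. measure axb_rho R \<le> 2 ^ CARD('n) * measure axb_rho T \<and>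
      2 * measure axb_rho T \<le> measure axb_rho R))"

lemma CZ_kids:
  fixes R :: "((real ^ 'n) \<times> real) set"
  assumes "R \<in> CZ_sets"
  shows "finite (CZ_kids R)" "CZ_kids R \<subseteq> CZ_sets" "\<Union>(CZ_kids R) = R"
    "\<And>T T'. T \<in> CZ_kids R \<Longrightarrow> T' \<in> CZ_kids R \<Longrightarrow> T \<noteq> T' \<Longrightarrow>
       AE x in axb_rho. \<not> (x \<in> T \<and> x \<in> T')"
    "\<And>T. T \<in> CZ_kids R \<Longrightarrow> measure axb_rho R \<le> 2 ^ CARD('n) * measure axb_rho T"
    "\<And>T. T \<in> CZ_kids R \<Longrightarrow> 2 * measure axb_rho T \<le> measure axb_rho R"
proof -
  note * = someI_ex[OF CZ_set_split[OF assms], folded CZ_kids_def]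
  from * show "finite (CZ_kids R)" by (elim conjE)
  from * show "CZ_kids R \<subseteq> CZ_sets" by (elim conjE)
  from * show "\<Union>(CZ_kids R) = R" by (elim conjE)
  from * have dis: "\<forall>T\<in>CZ_kids R. \<forall>T'\<in>CZ_kids R. T \<noteq> T' \<longrightarrow>
      (AE x in axb_rho. \<not> (x \<in> T \<and> x \<in> T'))"
    by (elim conjE)
  from * have size: "\<forall>T\<in>CZ_kids R. measure axb_rho R \<le> 2 ^ CARD('n) * measure axb_rho T \<and>
      2 * measure axb_rho T \<le> measure axb_rho R"
    by (elim conjE)
  show "AE x in axb_rho. \<not> (x \<in> T \<and> x \<in> T')"
    if "T \<in> CZ_kids R" "T' \<in> CZ_kids R" "T \<noteq> T'" for T T'
    using dis[rule_format, OF that] .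
  show "measure axb_rho R \<le> 2 ^ CARD('n) * measure axb_rho T"
    "2 * measure axb_rho T \<le> measure axb_rho R" if "T \<in> CZ_kids R" for T
    using bspec[OF size that] by simp_all
qed

lemma CZ_set_sets_pos:
  assumes "S \<in> CZ_sets"
  shows "S \<in> sets axb_rho" "0 < measure axb_rho S"
proof -
  obtain k m a r where "S = CZ_box k m a r" "0 < a" "0 < r"
    using assms by (rule CZ_setsE)
  then show "S \<in> sets axb_rho" "0 < measure axb_rho S"
    by (simp_all add: CZ_box_sets measure_CZ_box)
qed

lemma CZ_set_subset_compact:
  fixes S :: "((real ^ 'n) \<times> real) set"
  assumes "S \<in> CZ_sets"
  obtains K \<alpha> \<beta> where "compact K" "S \<subseteq> K" "0 < \<alpha>" "K \<subseteq> UNIV \<times> {\<alpha>..\<beta>}"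
proof -
  obtain k m a r where S: "S = CZ_box k m a r" and ar: "0 < a" "0 < r"
    using assms by (rule CZ_setsE)
  let ?K = "cbox (\<chi> i. (2::real) powi k * of_int (m i)) (\<chi> i. 2 powi k * (of_int (m i) + 1)) \<times> {a * exp (- r)..a * exp r}"
  show ?thesis
  proof (rule that)
    show "compact ?K" by (intro compact_Times compact_cbox compact_Icc)
    show "S \<subseteq> ?K" unfolding S CZ_box_def using dyadic_cube_subset_cbox[of k m] by blast
    show "?K \<subseteq> UNIV \<times> {a * exp (- r)..a * exp r}" by blast
    show "0 < a * exp (- r)" using ar by simp
  qed
qed

text \<open>
  Admissibility gives \<open>L \<ge> a r\<close>, so a small measure \<open>2 r L\<^sup>d\<close> forces \<open>r\<close> to be small when \<open>a \<ge> \<alpha>\<close>.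
  For \<open>r < 1\<close> admissibility gives \<open>L < exp(8) a r\<close>, so \<open>L\<close> and the length of the interval are small as well,
  because \<open>a \<le> \<beta>\<close>.
\<close>

lemma CZ_set_diameter_small:
  assumes "0 < \<alpha>" "0 < \<delta>"
  shows "\<exists>\<epsilon>>0. \<forall>T\<in>(CZ_sets :: ((real ^ 'n) \<times> real) set set). T \<subseteq> UNIV \<times> {\<alpha>..\<beta>} \<longrightarrow>
    measure axb_rho T < \<epsilon> \<longrightarrow> (\<forall>x\<in>T. \<forall>y\<in>T. dist x y < \<delta>)"
proof -
  define C where "C = (real CARD('n) * exp 8 + 4) * (\<bar>\<beta>\<bar> + 1)"
  have C: "0 < C" unfolding C_def by (intro mult_pos_pos add_nonneg_pos) auto
  define s where "s = min 1 (\<delta> / C)"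
  have s: "0 < s" "s \<le> 1" "C * s \<le> \<delta>"
    using C \<open>0 < \<delta>\<close> by (auto simp: s_def min_def field_simps)
  show ?thesis
  proof (intro exI[of _ "(\<alpha> * s) ^ CARD('n) * (2 * s)"] conjI ballI impI)
    show "0 < (\<alpha> * s) ^ CARD('n) * (2 * s)" using s \<open>0 < \<alpha>\<close> by simp
    fix T :: "((real ^ 'n) \<times> real) set" and x y
    assume T: "T \<in> CZ_sets" and sub: "T \<subseteq> UNIV \<times> {\<alpha>..\<beta>}"
      and small: "measure axb_rho T < (\<alpha> * s) ^ CARD('n) * (2 * s)" and xy: "x \<in> T" "y \<in> T"
    obtain k m a r where R: "T = CZ_box k m a r" and ar: "0 < a" "0 < r"
      and adm: "CZ_admissible (2 powi k) a r" using T by (rule CZ_setsE)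
    define L :: real where "L = 2 powi k"
    \<comment> \<open>The centre \<open>a\<close> of the interval satisfies the bounds imposed on the set.\<close>
    have "(fst x, a) \<in> T" using xy(1) ar by (auto simp: R CZ_box_def)
    then have a: "\<alpha> \<le> a" "a \<le> \<beta>" using sub by auto
    have "a * r \<le> L"
    proof (cases "r < 1")
      case True
      have "1 * (a * r) \<le> exp 2 * (a * r)" using ar by (intro mult_right_mono) auto
      then show ?thesis using adm True by (simp add: CZ_admissible_def L_def mult.assoc)
    next
      case False
      have "r \<le> exp (2 * r)" using exp_ge_add_one_self[of "2 * r"] ar by linarith
      then have "a * r \<le> a * exp (2 * r)" using ar by simp
      then show ?thesis using adm False by (simp add: CZ_admissible_def L_def)
    qed
    have "r < s"
    proof (rule ccontr)
      assume "\<not> r < s"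
      then have "\<alpha> * s \<le> a * r" using a \<open>0 < \<alpha>\<close> s by (intro mult_mono) auto
      then have "\<alpha> * s \<le> L" using \<open>a * r \<le> L\<close> by linarith
      then have "(\<alpha> * s) ^ CARD('n) * (2 * s) \<le> L ^ CARD('n) * (2 * r)"
        using \<open>\<not> r < s\<close> s \<open>0 < \<alpha>\<close> by (intro mult_mono power_mono) (auto simp: L_def)
      then show False using small ar by (simp add: R measure_CZ_box L_def)
    qed
    have r1: "r < 1" using \<open>r < s\<close> s by linarith
    have L: "L < exp 8 * a * r" using adm r1 by (simp add: CZ_admissible_def L_def)
    have d1: "dist (fst x) (fst y) \<le> real CARD('n) * L"
    proof -
      have "\<bar>(fst x - fst y) $ i\<bar> \<le> L" for i
      proof -
        have "L * of_int (m i) \<le> fst x $ i" "fst x $ i < L * of_int (m i) + L"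
          "L * of_int (m i) \<le> fst y $ i" "fst y $ i < L * of_int (m i) + L"
          using xy by (auto simp: R CZ_box_def dyadic_cube_def L_def algebra_simps)
        then show ?thesis by (simp add: abs_le_iff)
      qed
      then have "(\<Sum>i\<in>UNIV. \<bar>(fst x - fst y) $ i\<bar>) \<le> real CARD('n) * L"
        by (intro sum_bounded_above) auto
      then show ?thesis using norm_le_l1_cart[of "fst x - fst y"] by (simp add: dist_norm)
    qed
    have d2: "dist (snd x) (snd y) \<le> 4 * (a * r)"
    proof -
      have "exp r - exp (- r) \<le> 4 * r"
      proof -
        have e: "1 - r \<le> exp (- r)" using exp_ge_add_one_self[of "- r"] by simp
        have "exp r \<le> 3" using exp_le r1 by (meson exp_le_cancel_iff less_imp_le order_trans)
        have "exp r * (1 - r) \<le> exp r * exp (- r)" using e by (intro mult_left_mono) auto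
        then have "exp r - 1 \<le> exp r * r" by (simp add: algebra_simps flip: exp_add)
        also have "\<dots> \<le> 3 * r" using \<open>exp r \<le> 3\<close> ar by (intro mult_right_mono) auto
        finally show ?thesis using e by linarith
      qed
      then have "a * (exp r - exp (- r)) \<le> a * (4 * r)" using ar by (intro mult_left_mono) auto
      then have w: "a * exp r - a * exp (- r) \<le> 4 * (a * r)" by (simp add: algebra_simps)
      have "a * exp (- r) \<le> snd x" "snd x \<le> a * exp r" "a * exp (- r) \<le> snd y" "snd y \<le> a * exp r"
        using xy by (auto simp: R CZ_box_def)
      then show ?thesis using w by (simp add: dist_real_def abs_le_iff)
    qed
    have "dist x y \<le> dist (fst x) (fst y) + dist (snd x) (snd y)"
      using norm_Pair_le[of "fst x - fst y" "snd x - snd y"]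
      by (simp add: dist_norm) (metis fst_diff prod.collapse snd_diff)
    also have "\<dots> \<le> real CARD('n) * (exp 8 * a * r) + 4 * (a * r)"
      using d1 d2 L by (intro add_mono) (auto intro!: order_trans[OF d1] mult_left_mono)
    also have "\<dots> = (real CARD('n) * exp 8 + 4) * (a * r)" by (simp add: algebra_simps)
    also have "\<dots> < (real CARD('n) * exp 8 + 4) * ((\<bar>\<beta>\<bar> + 1) * s)"
    proof (rule mult_strict_left_mono)
      show "a * r < (\<bar>\<beta>\<bar> + 1) * s"
        using a ar \<open>r < s\<close> by (intro mult_strict_mono) auto
    qed (intro add_nonneg_pos, auto)
    also have "\<dots> \<le> \<delta>" using s(3) by (simp add: C_def mult.assoc)
    finally show "dist x y < \<delta>" .
  qed
qed

lemma CZ_generation: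
  fixes R :: "((real ^ 'n) \<times> real) set"
  assumes "R \<in> CZ_sets" "T \<in> generation CZ_kids n R"
  shows "T \<in> CZ_sets \<and> T \<subseteq> R \<and> 2 ^ n * measure axb_rho T \<le> measure axb_rho R"
  using assms
proof (induction n arbitrary: R)
  case (Suc n)
  then obtain U where U: "U \<in> CZ_kids R" "T \<in> generation CZ_kids n U" by auto
  have "U \<in> CZ_sets" "U \<subseteq> R" "2 * measure axb_rho U \<le> measure axb_rho R"
    using CZ_kids[OF Suc.prems(1)] U(1) by auto
  moreover note Suc.IH[OF \<open>U \<in> CZ_sets\<close> U(2)]
  ultimately show ?case by auto
qed simp

lemma CZ_mesh:
  fixes S :: "((real ^ 'n) \<times> real) set"
  assumes S: "S \<in> CZ_sets" and "0 < \<delta>"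
  shows "\<exists>n. \<forall>T\<in>generation CZ_kids n S. \<forall>x\<in>T. \<forall>y\<in>T. dist x y < \<delta>"
proof -
  obtain K \<alpha> \<beta> where "compact K" and K: "S \<subseteq> K" "0 < \<alpha>" "K \<subseteq> UNIV \<times> {\<alpha>..\<beta>}"
    using CZ_set_subset_compact[OF S] .
  from CZ_set_diameter_small[OF K(2) \<open>0 < \<delta>\<close>, of \<beta>]
  obtain \<epsilon> where \<epsilon>: "0 < \<epsilon>" and small: "\<forall>T\<in>(CZ_sets :: ((real ^ 'n) \<times> real) set set).
      T \<subseteq> UNIV \<times> {\<alpha>..\<beta>} \<longrightarrow> measure axb_rho T < \<epsilon> \<longrightarrow> (\<forall>x\<in>T. \<forall>y\<in>T. dist x y < \<delta>)"
    by (elim exE conjE)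
  obtain n where n: "measure axb_rho S / \<epsilon> < 2 ^ n"
    using real_arch_pow[of 2 "measure axb_rho S / \<epsilon>"] by auto
  show ?thesis
  proof (intro exI[of _ n] ballI)
    fix T x y assume T: "T \<in> generation CZ_kids n S" and xy: "x \<in> T" "y \<in> T"
    note g = CZ_generation[OF S T]
    have "measure axb_rho S < 2 ^ n * \<epsilon>" using n \<epsilon> by (simp add: divide_less_eq)
    with g have "2 ^ n * measure axb_rho T < 2 ^ n * \<epsilon>" by linarith
    then have "measure axb_rho T < \<epsilon>" by (rule mult_left_less_imp_less) simp
    moreover have "T \<in> CZ_sets" "T \<subseteq> UNIV \<times> {\<alpha>..\<beta>}" using g K by auto
    ultimately show "dist x y < \<delta>" using small xy by simp
  qed
qed

lemma CZ_outer_open: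
  assumes S: "S \<in> CZ_sets" and A: "A \<in> sets axb_rho" and "0 < e"
  shows "\<exists>U. open U \<and> A \<subseteq> U \<and> measure axb_rho (S \<inter> (U - A)) < e"
proof -
  obtain K \<alpha> \<beta> where "compact K" and K: "S \<subseteq> K" "0 < \<alpha>" "K \<subseteq> UNIV \<times> {\<alpha>..\<beta>}"
    using CZ_set_subset_compact[OF S] .
  have "A \<in> sets lebesgue" using A by (simp add: sets_axb_rho)
  then obtain U where U: "open U" "A \<subseteq> U" "U - A \<in> lmeasurable" "emeasure lebesgue (U - A) < ennreal (\<alpha> * e)"
    using sets_lebesgue_outer_open[of A "\<alpha> * e"] \<open>0 < e\<close> K(2) by auto
  have Sm: "S \<in> sets lebesgue" using CZ_set_sets_pos(1)[OF S] by (simp add: sets_axb_rho)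
  have m: "S \<inter> (U - A) \<in> sets lebesgue" using Sm U(3) by (auto simp: fmeasurable_def)
  have "emeasure axb_rho (S \<inter> (U - A)) \<le> ennreal (1 / \<alpha>) * emeasure lebesgue (S \<inter> (U - A))"
    using K by (intro emeasure_axb_rho_le_lebesgue m) auto
  also have "\<dots> \<le> ennreal (1 / \<alpha>) * emeasure lebesgue (U - A)"
    using U(3) by (intro mult_left_mono emeasure_mono) auto
  also have "\<dots> < ennreal (1 / \<alpha>) * ennreal (\<alpha> * e)"
    using U(4) K(2) by (intro ennreal_mult_strict_left_mono) auto
  also have "\<dots> = ennreal e" using K(2) \<open>0 < e\<close> by (simp flip: ennreal_mult)
  finally have "emeasure axb_rho (S \<inter> (U - A)) < ennreal e" .
  then have "measure axb_rho (S \<inter> (U - A)) < e"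
    unfolding measure_def using \<open>0 < e\<close> by (cases "emeasure axb_rho (S \<inter> (U - A))") (auto simp: ennreal_less_iff)
  then show ?thesis using U by blast
qed

interpretation CZ: metric_splitting_family axb_rho "CZ_sets :: ((real ^ 'n) \<times> real) set set" CZ_kids "2 ^ CARD('n)"
proof
  fix S T T' :: "((real ^ 'n) \<times> real) set" assume S: "S \<in> CZ_sets"
  show "S \<in> sets axb_rho" "0 < measure axb_rho S" using CZ_set_sets_pos[OF S] .
  show "finite (CZ_kids S)" "CZ_kids S \<subseteq> CZ_sets" "\<Union> (CZ_kids S) = S" using CZ_kids[OF S] by auto
  show "AE x in axb_rho. \<not> (x \<in> T \<and> x \<in> T')" if "T \<in> CZ_kids S" "T' \<in> CZ_kids S" "T \<noteq> T'"
    using CZ_kids(4)[OF S that] .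
  show "measure axb_rho S \<le> 2 ^ CARD('n) * measure axb_rho T" if "T \<in> CZ_kids S"
    using CZ_kids(5)[OF S that] .
  show "S \<inter> U \<in> sets axb_rho" if "open U" for U
  proof -
    have "U \<in> sets lebesgue" using that by (intro sets_completionI_sets) simp
    then show ?thesis using CZ_set_sets_pos(1)[OF S] by (auto simp: sets_axb_rho)
  qed
  show "\<exists>U. open U \<and> A \<subseteq> U \<and> measure axb_rho (S \<inter> (U - A)) < e" if "A \<in> sets axb_rho" "0 < e" for A e
    using CZ_outer_open[OF S that] .
  show "\<exists>n. \<forall>T\<in>generation CZ_kids n S. \<forall>x\<in>T. \<forall>y\<in>T. dist x y < \<delta>" if "0 < \<delta>" for \<delta>
    using CZ_mesh[OF S that] .
qed

lemma CZ_mean_eq_mean_on: "CZ_mean f R = mean_on axb_rho f R"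
  by (simp add: CZ_mean_def mean_on_def)

lemma BMO_set_integrable:
  assumes "f \<in> BMO" "S \<in> CZ_sets"
  shows "set_integrable axb_rho S f"
proof -
  obtain K \<alpha> \<beta> where K: "compact K" "S \<subseteq> K" "0 < \<alpha>" "K \<subseteq> UNIV \<times> {\<alpha>..\<beta>}"
    using CZ_set_subset_compact[OF assms(2)] .
  have "K \<subseteq> axb_carrier" using K by (fastforce simp: axb_carrier_def)
  then have "set_integrable axb_rho K f"
    using assms(1) K(1) by (auto simp: BMO_def axb_locally_integrable_def)
  then show ?thesis
    by (rule set_integrable_subset) (use K CZ_set_sets_pos[OF assms(2)] in auto)
qed

lemma BMO_oscillation_le:
  assumes f: "f \<in> BMO" and S: "S \<in> CZ_sets"
  shows "oscillation axb_rho f S \<le> enn2real (BMO_norm f) * measure axb_rho S"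
proof -
  note Sp = CZ_set_sets_pos[OF S]
  have int: "set_integrable axb_rho S (\<lambda>x. norm (f x - CZ_mean f S))"
    by (rule set_integrable_norm_diff_const[OF Sp BMO_set_integrable[OF f S]])
  have osc0: "0 \<le> oscillation axb_rho f S"
    unfolding oscillation_def by (rule set_integral_norm_nonneg)
  have "(\<integral>\<^sup>+p\<in>S. ennreal (norm (f p - CZ_mean f S)) \<partial>axb_rho)
      = (\<integral>\<^sup>+p. ennreal (indicator S p *\<^sub>R norm (f p - CZ_mean f S)) \<partial>axb_rho)"
    by (intro nn_integral_cong) (auto simp: indicator_def)
  also have "\<dots> = ennreal (oscillation axb_rho f S)"
    unfolding oscillation_def set_lebesgue_integral_def CZ_mean_eq_mean_on[symmetric]
    using int by (intro nn_integral_eq_integral) (auto simp: set_integrable_def)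
  finally have nn: "(\<integral>\<^sup>+p\<in>S. ennreal (norm (f p - CZ_mean f S)) \<partial>axb_rho) = ennreal (oscillation axb_rho f S)" .
  have em: "emeasure axb_rho S = ennreal (measure axb_rho S)"
    using emeasure_finite_if_measure_pos[OF Sp(2)] by (intro emeasure_eq_ennreal_measure) simp
  have "ennreal (oscillation axb_rho f S / measure axb_rho S)
      = (\<integral>\<^sup>+p\<in>S. ennreal (norm (f p - CZ_mean f S)) \<partial>axb_rho) / emeasure axb_rho S"
    unfolding nn em using osc0 Sp(2) by (simp add: divide_ennreal)
  also have "\<dots> \<le> BMO_norm f" unfolding BMO_norm_def by (rule SUP_upper[OF S])
  also have "\<dots> = ennreal (enn2real (BMO_norm f))" using f by (simp add: BMO_def)
  finally have "oscillation axb_rho f S / measure axb_rho S \<le> enn2real (BMO_norm f)"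
    by (simp add: ennreal_le_iff)
  then show ?thesis using Sp(2) by (simp add: divide_le_eq)
qed

theorem theorem3p2:
  "\<exists>\<eta>>0::real. \<exists>A>0::real. \<forall>f\<in>(BMO :: ((real ^ 'n) \<times> real \<Rightarrow> complex) set).
     BMO_norm f \<noteq> 0 \<longrightarrow>
     (SUP R\<in>CZ_sets.
        (\<integral>\<^sup>+p\<in>R. ennreal (exp (\<eta> / enn2real (BMO_norm f) * norm (f p - CZ_mean f R))) \<partial>axb_rho)
          / emeasure axb_rho R)
     \<le> ennreal A"
proof (intro exI conjI ballI impI)
  show "0 < ln (3/2) / (2 + 2 ^ CARD('n) :: real)" by (intro divide_pos_pos add_pos_pos) auto
  show "0 < (6::real)" by simp
  fix f :: "(real ^ 'n) \<times> real \<Rightarrow> complex"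
  assume f: "f \<in> BMO" and "BMO_norm f \<noteq> 0"
  let ?B = "enn2real (BMO_norm f)"
  have B: "0 < ?B"
    using f \<open>BMO_norm f \<noteq> 0\<close> by (auto simp: BMO_def enn2real_positive_iff zero_less_iff_neq_zero)
  show "(SUP R\<in>CZ_sets. (\<integral>\<^sup>+p\<in>R. ennreal (exp (ln (3/2) / (2 + 2 ^ CARD('n)) / ?B *
      norm (f p - CZ_mean f R))) \<partial>axb_rho) / emeasure axb_rho R) \<le> ennreal 6"
  proof (rule SUP_least)
    fix R :: "((real ^ 'n) \<times> real) set" assume R: "R \<in> CZ_sets"
    note Rp = CZ_set_sets_pos[OF R]
    have em: "emeasure axb_rho R = ennreal (measure axb_rho R)"
      using emeasure_finite_if_measure_pos[OF Rp(2)] by (intro emeasure_eq_ennreal_measure) simp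
    have "(\<integral>\<^sup>+p\<in>R. ennreal (exp (ln (3/2) / (2 + 2 ^ CARD('n)) / ?B * norm (f p - CZ_mean f R))) \<partial>axb_rho)
        \<le> ennreal (6 * measure axb_rho R)"
      unfolding CZ_mean_eq_mean_on
      by (rule CZ.John_Nirenberg[OF B _ R BMO_set_integrable[OF f] BMO_oscillation_le[OF f]]) auto
    also have "\<dots> = emeasure axb_rho R * ennreal 6"
      by (simp add: em ennreal_mult mult.commute)
    finally show "(\<integral>\<^sup>+p\<in>R. ennreal (exp (ln (3/2) / (2 + 2 ^ CARD('n)) / ?B *
        norm (f p - CZ_mean f R))) \<partial>axb_rho) / emeasure axb_rho R \<le> ennreal 6"
      using Rp(2) by (intro divide_le_posI_ennreal) (auto simp: em)
  qed
qed

end
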